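(* Let $(\mathcal{H},[\cdot,\cdot])$ be a Krein space with fundamental symmetry $J$ and let $T\in L(\ell_2(I),\mathcal{H})$ be surjective. Then $T$ is the synthesis operator of a $J$-frame for $\mathcal{H}$ if and only if there exists $I_+\subset I$ such that $\ell_2(I_+)$ (as a subspace of $\ell_2(I)$) satisfies $c(N(T)^\perp,\ell_2(I_+))<1$ and \[ TP_+T^\dagger\in\mathcal{Q}, \] where $P_+\in L(\ell_2(I))$ is the orthogonal projection onto $\ell_2(I_+)$.
   Context: Krein space setting: $(\mathcal{H},[\cdot,\cdot])$ is a complex separable Krein space with a fixed fundamental decomposition $\mathcal{H}=\mathcal{H}_+\dotplus\mathcal{H}_-$ (the summands are $[\cdot,\cdot]$-orthogonal and $(\mathcal{H}_\pm,\pm[\cdot,\cdot])$ are Hilbert spaces). $\langle\cdot,\cdot\rangle$ is the inner product making $\mathcal{H}$ the orthogonal direct sum of these Hilbert spaces, $\|\cdot\|$ its norm, and the fundamental symmetry $J$ (a selfadjoint unitary) satisfies $[x,y]=\langle Jx,y\rangle$. $L(\cdot,\cdot)$ denotes bounded linear operators, $R(\cdot)$, $N(\cdot)$ range and nullspace, and $T^\dagger$ the Moore–Penrose inverse of the closed range operator $T$. A subspace $\mathcal{S}$ is uniformly $J$-positive (resp. uniformly $J$-negative) if there is $\alpha>0$ with $[x,x]\ge\alpha\|x\|^2$ (resp. $[x,x]\le-\alpha\|x\|^2$) for all $x\in\mathcal{S}$. "Maximal" means maximal with respect to inclusion among such subspaces. $\mathcal{Q}=\{Q\in L(\mathcal{H}):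 Q^2=Q,\ R(Q)\text{ is uniformly } J\text{-positive and } N(Q)\text{ is uniformly } J\text{-negative}\}$. For closed subspaces $\mathcal{S},\mathcal{T}$ of a Hilbert space, $\mathcal{S}\ominus\mathcal{T}:=\mathcal{S}\cap(\mathcal{S}\cap\mathcal{T})^\perp$, and the cosine of the Friedrichs angle is $c(\mathcal{S},\mathcal{T})=\sup\{|\langle x,y\rangle|:x\in\mathcal{S}\ominus\mathcal{T},\ \|x\|=1,\ y\in\mathcal{T}\ominus\mathcal{S},\ \|y\|=1\}$ (with $\sup\emptyset=0$). A Bessel family is a family $\mathcal{F}=\{f_i\}_{i\in I}$ in $\mathcal{H}$ with $\sum_i|\langle f,f_i\rangle|^2\le B\|f\|^2$ for all $f$ and some $B<\infty$. Its synthesis operator is $T\in L(\ell_2(I),\mathcal{H})$, $Te_i=f_i$, with $\{e_i\}$ the standard orthonormal basis. The Bessel family $\mathcal{F}$ is a $J$-frame for $\mathcal{H}$ if, with $K_+=\{i\in I:[f_i,f_i]\ge0\}$ and $K_-=\{i\in I:[f_i,f_i]<0\}$, the subspace $T(\ell_2(K_+))$ is maximal uniformly $J$-positive and $T(\ell_2(K_-))$ is maximal uniformly $J$-negative in $\mathcal{H}$. *)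

theory Defs
  imports "HOL-Analysis.Analysis"
begin

text \<open>HOL-Analysis only has real inner product spaces. Inner products are linear in the first
  and antilinear in the second argument.\<close>

class complex_inner = real_normed_vector +
  fixes scaleC :: "complex \<Rightarrow> 'a \<Rightarrow> 'a" (infixr "*\<^sub>C" 75)
    and cinner :: "'a \<Rightarrow> 'a \<Rightarrow> complex"
  assumes scaleC_add_right: "a *\<^sub>C (x + y) = a *\<^sub>C x + a *\<^sub>C y"
    and scaleC_add_left: "(a + b) *\<^sub>C x = a *\<^sub>C x + b *\<^sub>C x"
    and scaleC_scaleC: "a *\<^sub>C b *\<^sub>C x = (a * b) *\<^sub>C x"
    and scaleR_scaleC: "r *\<^sub>R x = complex_of_real r *\<^sub>C x"
    and cinner_add_left: "cinner (x + y) z = cinner x z + cinner y z"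
    and cinner_scaleC_left: "cinner (a *\<^sub>C x) y = a * cinner x y"
    and cinner_commute: "cinner x y = cnj (cinner y x)"
    and cinner_self: "cinner x x = complex_of_real ((norm x)\<^sup>2)"

class chilbert_space = complex_inner + complete_space

subclass (in chilbert_space) banach ..

definition csubspace :: "'a::complex_inner set \<Rightarrow> bool" where
  "csubspace S \<longleftrightarrow> subspace S \<and> (\<forall>c. \<forall>x\<in>S. c *\<^sub>C x \<in> S)"

definition bounded_clinear :: "('a::complex_inner \<Rightarrow> 'b::complex_inner) \<Rightarrow> bool" where
  "bounded_clinear A \<longleftrightarrow> bounded_linear A \<and> (\<forall>c x. A (c *\<^sub>C x) = c *\<^sub>C A x)"

definition null_space :: "('a \<Rightarrow> 'b::zero) \<Rightarrow> 'a set" where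
  "null_space A = {x. A x = 0}"

definition orth_compl :: "'a::complex_inner set \<Rightarrow> 'a set" where
  "orth_compl S = {x. \<forall>y\<in>S. cinner x y = 0}"

definition orth_proj :: "'a::complex_inner set \<Rightarrow> 'a \<Rightarrow> 'a" where
  "orth_proj S x = (THE p. p \<in> S \<and> x - p \<in> orth_compl S)"

definition selfadjoint_op :: "('a::complex_inner \<Rightarrow> 'a) \<Rightarrow> bool" where
  "selfadjoint_op A \<longleftrightarrow> (\<forall>x y. cinner (A x) y = cinner x (A y))"

text \<open>The four Penrose equations. A bounded solution exists iff \<open>A\<close> has closed range, and it is
  then unique; the value is unspecified if the range is not closed.\<close>

definition moore_penrose :: "('a::complex_inner \<Rightarrow> 'b::complex_inner) \<Rightarrow> 'b \<Rightarrow> 'a" where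
  "moore_penrose A = (THE X. bounded_clinear X
      \<and> A \<circ> X \<circ> A = A \<and> X \<circ> A \<circ> X = X
      \<and> selfadjoint_op (A \<circ> X) \<and> selfadjoint_op (X \<circ> A))"

definition ominus :: "'a::complex_inner set \<Rightarrow> 'a set \<Rightarrow> 'a set" where
  "ominus S T = S \<inter> orth_compl (S \<inter> T)"

definition friedrichs_cos :: "'a::complex_inner set \<Rightarrow> 'a set \<Rightarrow> real" where
  "friedrichs_cos S T =
    (let V = {cmod (cinner x y) |x y.
                x \<in> ominus S T \<and> norm x = 1 \<and> y \<in> ominus T S \<and> norm y = 1}
     in if V = {} then 0 else Sup V)"


text \<open>The index set \<open>I\<close> is the universe of the type \<open>'i\<close>; it is thus nonempty, of arbitrary cardinality.\<close>

typedef 'i ell2 = "{x :: 'i \<Rightarrow> complex. (\<lambda>i. (cmod (x i))\<^sup>2) summable_on UNIV}"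
  morphisms ell2_nth Abs_ell2
  by (rule exI[of _ "\<lambda>_. 0"]) simp

setup_lifting type_definition_ell2

lemma ell2_summable: "(\<lambda>i. (cmod (ell2_nth x i))\<^sup>2) summable_on UNIV"
  using ell2_nth[of x] by simp

lemma sq_summable_add:
  fixes x y :: "'i \<Rightarrow> complex"
  assumes "(\<lambda>i. (cmod (x i))\<^sup>2) summable_on UNIV" "(\<lambda>i. (cmod (y i))\<^sup>2) summable_on UNIV"
  shows "(\<lambda>i. (cmod (x i + y i))\<^sup>2) summable_on UNIV"
proof (rule summable_on_comparison_test)
  show "(\<lambda>i. 2 * (cmod (x i))\<^sup>2 + 2 * (cmod (y i))\<^sup>2) summable_on UNIV"
    by (intro summable_on_add summable_on_cmult_right assms)
  fix i
  have "(cmod (x i + y i))\<^sup>2 \<le> (cmod (x i) + cmod (y i))\<^sup>2"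
    by (intro power_mono norm_triangle_ineq) simp
  also have "\<dots> \<le> 2 * (cmod (x i))\<^sup>2 + 2 * (cmod (y i))\<^sup>2"
    using sum_squares_bound[of "cmod (x i)" "cmod (y i)"] by (simp add: power2_sum)
  finally show "(cmod (x i + y i))\<^sup>2 \<le> 2 * (cmod (x i))\<^sup>2 + 2 * (cmod (y i))\<^sup>2" .
qed simp

lemma sq_summable_scale:
  fixes x :: "'i \<Rightarrow> complex"
  assumes "(\<lambda>i. (cmod (x i))\<^sup>2) summable_on UNIV"
  shows "(\<lambda>i. (cmod (c * x i))\<^sup>2) summable_on UNIV"
  using summable_on_cmult_right[OF assms, of "(cmod c)\<^sup>2"]
  by (simp add: norm_mult power_mult_distrib)

lemma ell2_inner_summable:
  "(\<lambda>i. ell2_nth x i * cnj (ell2_nth y i)) summable_on UNIV"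
proof (rule Infinite_Sum.abs_summable_summable, rule Infinite_Sum.abs_summable_on_comparison_test')
  show "(\<lambda>i. (cmod (ell2_nth x i))\<^sup>2 + (cmod (ell2_nth y i))\<^sup>2) summable_on UNIV"
    by (intro summable_on_add ell2_summable)
  fix i
  have "cmod (ell2_nth x i) * cmod (ell2_nth y i)
      \<le> (cmod (ell2_nth x i))\<^sup>2 + (cmod (ell2_nth y i))\<^sup>2"
    using sum_squares_bound[of "cmod (ell2_nth x i)" "cmod (ell2_nth y i)"]
      mult_nonneg_nonneg[OF norm_ge_zero norm_ge_zero, of "ell2_nth x i" "ell2_nth y i"]
    by linarith
  then show "cmod (ell2_nth x i * cnj (ell2_nth y i))
      \<le> (cmod (ell2_nth x i))\<^sup>2 + (cmod (ell2_nth y i))\<^sup>2"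
    by (simp add: norm_mult)
qed

instantiation ell2 :: (type) complex_inner
begin

lift_definition zero_ell2 :: "'a ell2" is "\<lambda>_. 0" by simp
lift_definition plus_ell2 :: "'a ell2 \<Rightarrow> 'a ell2 \<Rightarrow> 'a ell2" is "\<lambda>x y i. x i + y i"
  by (rule sq_summable_add)
lift_definition uminus_ell2 :: "'a ell2 \<Rightarrow> 'a ell2" is "\<lambda>x i. - x i" by simp
lift_definition minus_ell2 :: "'a ell2 \<Rightarrow> 'a ell2 \<Rightarrow> 'a ell2" is "\<lambda>x y i. x i - y i"
  subgoal for x y using sq_summable_add[of x "\<lambda>i. - y i"] by simp done
lift_definition scaleC_ell2 :: "complex \<Rightarrow> 'a ell2 \<Rightarrow> 'a ell2" is "\<lambda>c x i. c * x i"
  by (rule sq_summable_scale)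
lift_definition scaleR_ell2 :: "real \<Rightarrow> 'a ell2 \<Rightarrow> 'a ell2" is "\<lambda>r x i. complex_of_real r * x i"
  by (rule sq_summable_scale)

definition "cinner x y = (\<Sum>\<^sub>\<infinity>i. ell2_nth x i * cnj (ell2_nth y i))" for x y :: "'a ell2"
definition "norm x = sqrt (\<Sum>\<^sub>\<infinity>i. (cmod (ell2_nth x i))\<^sup>2)" for x :: "'a ell2"
definition "dist x y = norm (x - y)" for x y :: "'a ell2"
definition "sgn x = inverse (norm x) *\<^sub>R x" for x :: "'a ell2"
definition [code del]:
  "(uniformity :: ('a ell2 \<times> 'a ell2) filter) = (INF e\<in>{0<..}. principal {(x, y). dist x y < e})"
definition [code del]:
  "open (U :: 'a ell2 set) \<longleftrightarrow> (\<forall>x\<in>U. eventually (\<lambda>(x', y). x' = x \<longrightarrow> y \<in> U) uniformity)"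

lemma ell2_norm_sq: "(norm x)\<^sup>2 = (\<Sum>\<^sub>\<infinity>i. (cmod (ell2_nth x i))\<^sup>2)" for x :: "'a ell2"
  unfolding norm_ell2_def by (simp add: infsum_nonneg)

lemma ell2_L2_set_le: "L2_set (\<lambda>i. cmod (ell2_nth x i)) F \<le> norm x" for x :: "'a ell2"
proof (cases "finite F")
  case True
  then show ?thesis
    unfolding norm_ell2_def L2_set_def
    by (intro real_sqrt_le_mono finite_sum_le_infsum ell2_summable) auto
qed (simp add: norm_ell2_def infsum_nonneg)

lemma ell2_norm_le:
  fixes x :: "'a ell2"
  assumes "\<And>F. finite F \<Longrightarrow> L2_set (\<lambda>i. cmod (ell2_nth x i)) F \<le> b" "0 \<le> b"
  shows "norm x \<le> b"
proof -
  have "(\<Sum>\<^sub>\<infinity>i. (cmod (ell2_nth x i))\<^sup>2) \<le> b\<^sup>2"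
  proof (rule infsum_le_finite_sums[OF ell2_summable])
    fix F :: "'a set" assume "finite F"
    then show "(\<Sum>i\<in>F. (cmod (ell2_nth x i))\<^sup>2) \<le> b\<^sup>2"
      using assms(1)[of F] unfolding L2_set_def by (metis sqrt_le_D)
  qed
  then show ?thesis
    unfolding norm_ell2_def using assms(2) by (rule real_le_lsqrt[rotated])
qed

instance
proof
  fix x y z :: "'a ell2" and a b :: complex and r s :: real and U :: "'a ell2 set"
  show "x + y + z = x + (y + z)" "x + y = y + x" "0 + x = x" "- x + x = 0" "x - y = x + - y"
    by (transfer; simp add: algebra_simps)+
  show "r *\<^sub>R (x + y) = r *\<^sub>R x + r *\<^sub>R y" "(r + s) *\<^sub>R x = r *\<^sub>R x + s *\<^sub>R x"
    "r *\<^sub>R s *\<^sub>R x = (r * s) *\<^sub>R x" "1 *\<^sub>R x = x"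
    by (transfer; simp add: algebra_simps)+
  show "a *\<^sub>C (x + y) = a *\<^sub>C x + a *\<^sub>C y" "(a + b) *\<^sub>C x = a *\<^sub>C x + b *\<^sub>C x"
    "a *\<^sub>C b *\<^sub>C x = (a * b) *\<^sub>C x" "r *\<^sub>R x = complex_of_real r *\<^sub>C x"
    by (transfer; simp add: algebra_simps)+
  show "dist x y = norm (x - y)" "sgn x = inverse (norm x) *\<^sub>R x"
    by (simp_all add: dist_ell2_def sgn_ell2_def)
  show "(uniformity :: ('a ell2 \<times> 'a ell2) filter)
      = (INF e\<in>{0<..}. principal {(x, y). dist x y < e})"
    by (simp add: uniformity_ell2_def)
  show "open U \<longleftrightarrow> (\<forall>x\<in>U. eventually (\<lambda>(x', y). x' = x \<longrightarrow> y \<in> U) uniformity)"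
    by (simp add: open_ell2_def)
  show "cinner (x + y) z = cinner x z + cinner y z"
    unfolding cinner_ell2_def plus_ell2.rep_eq
    by (simp add: ring_distribs infsum_add ell2_inner_summable)
  show "cinner (a *\<^sub>C x) y = a * cinner x y"
    unfolding cinner_ell2_def scaleC_ell2.rep_eq
    by (simp add: mult.assoc infsum_cmult_right')
  show "cinner x y = cnj (cinner y x)"
    unfolding cinner_ell2_def infsum_cnj[symmetric] by (simp add: mult.commute)
  show "cinner x x = complex_of_real ((norm x)\<^sup>2)"
  proof -
    have "((\<lambda>i. complex_of_real ((cmod (ell2_nth x i))\<^sup>2)) has_sum
        complex_of_real (\<Sum>\<^sub>\<infinity>i. (cmod (ell2_nth x i))\<^sup>2)) UNIV"
      by (intro has_sum_of_real has_sum_infsum ell2_summable)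
    then show ?thesis
      unfolding cinner_ell2_def ell2_norm_sq
      by (simp only: complex_norm_square[symmetric] infsumI)
  qed
  show "norm x = 0 \<longleftrightarrow> x = 0"
  proof
    assume *: "norm x = 0"
    have "ell2_nth x i = 0" for i
      using ell2_L2_set_le[of x "{i}"] * by simp
    then show "x = 0" by transfer auto
  next
    assume "x = 0"
    then show "norm x = 0" by (simp add: norm_ell2_def zero_ell2.rep_eq)
  qed
  show "norm (x + y) \<le> norm x + norm y"
  proof (rule ell2_norm_le)
    fix F :: "'a set" assume "finite F"
    have "L2_set (\<lambda>i. cmod (ell2_nth (x + y) i)) F
        \<le> L2_set (\<lambda>i. cmod (ell2_nth x i) + cmod (ell2_nth y i)) F"
      by (rule L2_set_mono) (auto simp: plus_ell2.rep_eq norm_triangle_ineq)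
    also have "\<dots> \<le> L2_set (\<lambda>i. cmod (ell2_nth x i)) F + L2_set (\<lambda>i. cmod (ell2_nth y i)) F"
      by (rule L2_set_triangle_ineq)
    also have "\<dots> \<le> norm x + norm y"
      by (intro add_mono ell2_L2_set_le)
    finally show "L2_set (\<lambda>i. cmod (ell2_nth (x + y) i)) F \<le> norm x + norm y" .
  qed (simp add: norm_ell2_def infsum_nonneg)
  show "norm (r *\<^sub>R x) = \<bar>r\<bar> * norm x"
    by (simp add: norm_ell2_def scaleR_ell2.rep_eq norm_mult power_mult_distrib
        infsum_cmult_right' real_sqrt_mult)
qed

end

instance ell2 :: (type) chilbert_space
proof
  fix X :: "nat \<Rightarrow> 'a ell2" assume "Cauchy X"
  then have C: "\<exists>N. \<forall>m\<ge>N. \<forall>n\<ge>N. norm (X m - X n) < e" if "e > 0" for e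
    using that by (auto simp: Cauchy_def dist_norm)
  have "Cauchy (\<lambda>n. ell2_nth (X n) i)" for i
  proof (rule CauchyI)
    fix e :: real assume "e > 0"
    then obtain N where N: "\<forall>m\<ge>N. \<forall>n\<ge>N. norm (X m - X n) < e" using C by blast
    have "norm (ell2_nth (X m) i - ell2_nth (X n) i) \<le> norm (X m - X n)" for m n
      using ell2_L2_set_le[of "X m - X n" "{i}"] by (simp add: minus_ell2.rep_eq)
    then show "\<exists>N. \<forall>m\<ge>N. \<forall>n\<ge>N. norm (ell2_nth (X m) i - ell2_nth (X n) i) < e"
      using N by (meson le_less_trans)
  qed
  then have "\<exists>l. (\<lambda>n. ell2_nth (X n) i) \<longlonglongrightarrow> l" for i
    by (simp add: Cauchy_convergent_iff convergent_def)
  then obtain L where L: "\<And>i. (\<lambda>n. ell2_nth (X n) i) \<longlonglongrightarrow> L i" by metis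
  have fin: "L2_set (\<lambda>i. cmod (ell2_nth (X m) i - L i)) F \<le> e"
    if "\<forall>n\<ge>N. norm (X m - X n) < e" for m N F e
  proof (rule LIMSEQ_le_const2)
    show "(\<lambda>n. L2_set (\<lambda>i. cmod (ell2_nth (X m) i - ell2_nth (X n) i)) F)
        \<longlonglongrightarrow> L2_set (\<lambda>i. cmod (ell2_nth (X m) i - L i)) F"
      unfolding L2_set_def by (intro tendsto_intros L)
    have "L2_set (\<lambda>i. cmod (ell2_nth (X m) i - ell2_nth (X n) i)) F \<le> e" if "n \<ge> N" for n
      using ell2_L2_set_le[of "X m - X n" F] \<open>\<forall>n\<ge>N. norm (X m - X n) < e\<close> that
      by (force simp: minus_ell2.rep_eq)
    then show "\<exists>N. \<forall>n\<ge>N. L2_set (\<lambda>i. cmod (ell2_nth (X m) i - ell2_nth (X n) i)) F \<le> e"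
      by blast
  qed
  obtain M where M: "\<forall>n\<ge>M. norm (X M - X n) < 1" using C[of 1] by auto
  have "(\<lambda>i. (cmod (ell2_nth (X M) i - L i))\<^sup>2) summable_on UNIV"
  proof (rule nonneg_bounded_partial_sums_imp_summable_on)
    have "(\<Sum>i\<in>F. (cmod (ell2_nth (X M) i - L i))\<^sup>2) \<le> 1" for F
      using fin[OF M, of F] unfolding L2_set_def by simp
    then show "\<forall>\<^sub>F F in finite_subsets_at_top UNIV.
        (\<Sum>i\<in>F. (cmod (ell2_nth (X M) i - L i))\<^sup>2) \<le> 1"
      by simp
  qed simp
  then have "(\<lambda>i. (cmod (L i - ell2_nth (X M) i))\<^sup>2) summable_on UNIV"
    by (simp add: norm_minus_commute)
  from sq_summable_add[OF this ell2_summable[of "X M"]]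
  have Ls: "(\<lambda>i. (cmod (L i))\<^sup>2) summable_on UNIV" by simp
  define l where "l = Abs_ell2 L"
  have l: "ell2_nth l = L" unfolding l_def using Ls by (simp add: Abs_ell2_inverse)
  have "X \<longlonglongrightarrow> l"
  proof (rule LIMSEQ_I)
    fix e :: real assume "e > 0"
    then obtain N where N: "\<forall>m\<ge>N. \<forall>n\<ge>N. norm (X m - X n) < e / 2" using C[of "e/2"] by auto
    have "norm (X m - l) \<le> e / 2" if "m \<ge> N" for m
    proof (rule ell2_norm_le)
      fix F :: "'a set"
      show "L2_set (\<lambda>i. cmod (ell2_nth (X m - l) i)) F \<le> e / 2"
        using fin[of N m "e/2" F] N that by (simp add: minus_ell2.rep_eq l)
    qed (use \<open>e > 0\<close> in simp)
    then show "\<exists>N. \<forall>n\<ge>N. norm (X n - l) < e"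
      using \<open>e > 0\<close> by (intro exI[of _ N]) force
  qed
  then show "convergent X" by (auto simp: convergent_def)
qed

lift_definition ell2_basis :: "'i \<Rightarrow> 'i ell2" is "\<lambda>i j. if j = i then 1 else 0"
  subgoal for i
    by (rule finite_nonzero_values_imp_summable_on, rule finite_subset[of _ "{i}"]) auto
  done

text \<open>\<open>\<ell>\<^sub>2(K)\<close>, for \<open>K \<subseteq> I\<close>, as a subspace of \<open>\<ell>\<^sub>2(I)\<close>.\<close>

definition ell2_on :: "'i set \<Rightarrow> 'i ell2 set" where
  "ell2_on K = {x. \<forall>i. i \<notin> K \<longrightarrow> ell2_nth x i = 0}"


text \<open>The ambient Hilbert space structure of the type \<open>'h\<close> (\<open>cinner\<close>, and with it the norm) is
  required to be the one induced by the fundamental decomposition \<open>H\<^sub>+ \<dotplus> H\<^sub>-\<close>: see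
  \<open>cinner_eq\<close>, which for \<open>m = m' = 0\<close> resp. \<open>p = p' = 0\<close> says that \<open>\<plusminus>form\<close> is the
  inner product of \<open>H\<^sub>\<plusminus>\<close>.\<close>

locale krein_space =
  fixes form :: "'h::chilbert_space \<Rightarrow> 'h \<Rightarrow> complex"
    and Hp Hm :: "'h set"
    and J :: "'h \<Rightarrow> 'h"
  assumes separable: "separable_space (euclidean :: 'h topology)"
    and form_add_left: "form (x + y) z = form x z + form y z"
    and form_scaleC_left: "form (c *\<^sub>C x) y = c * form x y"
    and form_commute: "form x y = cnj (form y x)"
    and csubspace_Hp: "csubspace Hp" and csubspace_Hm: "csubspace Hm"
    and complete_Hp: "complete Hp" and complete_Hm: "complete Hm"
    and decomposition: "\<exists>p\<in>Hp. \<exists>m\<in>Hm. x = p + m" and inter_trivial: "Hp \<inter> Hm = {0}"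
    and form_orthogonal: "\<lbrakk>p \<in> Hp; m \<in> Hm\<rbrakk> \<Longrightarrow> form p m = 0"
    and cinner_eq: "\<lbrakk>p \<in> Hp; p' \<in> Hp; m \<in> Hm; m' \<in> Hm\<rbrakk>
      \<Longrightarrow> cinner (p + m) (p' + m') = form p p' - form m m'"
    and fundamental_symmetry: "\<lbrakk>p \<in> Hp; m \<in> Hm\<rbrakk> \<Longrightarrow> J (p + m) = p - m"
begin

lemma form_eq_cinner_J: "form x y = cinner (J x) y"
proof -
  obtain p m where x: "x = p + m" "p \<in> Hp" "m \<in> Hm" using decomposition by blast
  obtain p' m' where y: "y = p' + m'" "p' \<in> Hp" "m' \<in> Hm" using decomposition by blast
  have add_right: "form u (v + w) = form u v + form u w" for u v w
    by (metis form_commute form_add_left complex_cnj_add)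
  have "form m p' = 0" using form_orthogonal[OF y(2) x(3)] form_commute by (metis complex_cnj_zero)
  moreover have "form p m' = 0" using form_orthogonal x y by blast
  ultimately have 1: "form x y = form p p' + form m m'"
    by (simp add: x y form_add_left add_right)
  have neg: "- m \<in> Hm" using csubspace_Hm x(3) by (simp add: csubspace_def subspace_neg)
  have "form 0 m' = 0" "form (- m) m' + form m m' = form 0 m'"
    using form_add_left[of 0 0 m'] form_add_left[of "- m" m m'] by simp_all
  then have 2: "form (- m) m' = - form m m'" by (metis eq_neg_iff_add_eq_0)
  have "cinner (J x) y = cinner (p + - m) (p' + m')"
    using fundamental_symmetry[OF x(2,3)] by (simp add: x(1) y(1))
  also have "\<dots> = form p p' - form (- m) m'" using x y neg by (intro cinner_eq)
  finally show ?thesis using 1 2 by simp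
qed

end

text \<open>\<open>form x x\<close> is real for a Hermitian form, hence the real parts below.\<close>

definition unif_J_positive :: "('h::complex_inner \<Rightarrow> 'h \<Rightarrow> complex) \<Rightarrow> 'h set \<Rightarrow> bool" where
  "unif_J_positive form S \<longleftrightarrow>
    csubspace S \<and> (\<exists>\<alpha>>0. \<forall>x\<in>S. Re (form x x) \<ge> \<alpha> * (norm x)\<^sup>2)"

definition unif_J_negative :: "('h::complex_inner \<Rightarrow> 'h \<Rightarrow> complex) \<Rightarrow> 'h set \<Rightarrow> bool" where
  "unif_J_negative form S \<longleftrightarrow>
    csubspace S \<and> (\<exists>\<alpha>>0. \<forall>x\<in>S. Re (form x x) \<le> - \<alpha> * (norm x)\<^sup>2)"

definition max_unif_J_positive :: "('h::complex_inner \<Rightarrow> 'h \<Rightarrow> complex) \<Rightarrow> 'h set \<Rightarrow> bool" where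
  "max_unif_J_positive form S \<longleftrightarrow>
    unif_J_positive form S \<and> (\<forall>S'. unif_J_positive form S' \<and> S \<subseteq> S' \<longrightarrow> S' = S)"

definition max_unif_J_negative :: "('h::complex_inner \<Rightarrow> 'h \<Rightarrow> complex) \<Rightarrow> 'h set \<Rightarrow> bool" where
  "max_unif_J_negative form S \<longleftrightarrow>
    unif_J_negative form S \<and> (\<forall>S'. unif_J_negative form S' \<and> S \<subseteq> S' \<longrightarrow> S' = S)"

definition Q_set :: "('h::complex_inner \<Rightarrow> 'h \<Rightarrow> complex) \<Rightarrow> ('h \<Rightarrow> 'h) set" where
  "Q_set form = {Q. bounded_clinear Q \<and> Q \<circ> Q = Q
      \<and> unif_J_positive form (range Q) \<and> unif_J_negative form (null_space Q)}"


definition bessel_family :: "('i \<Rightarrow> 'h::complex_inner) \<Rightarrow> bool" where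
  "bessel_family f \<longleftrightarrow> (\<exists>B::real. \<forall>g.
      (\<lambda>i. (cmod (cinner g (f i)))\<^sup>2) summable_on UNIV
    \<and> (\<Sum>\<^sub>\<infinity>i. (cmod (cinner g (f i)))\<^sup>2) \<le> B * (norm g)\<^sup>2)"

definition is_synthesis_op :: "('i \<Rightarrow> 'h::complex_inner) \<Rightarrow> ('i ell2 \<Rightarrow> 'h) \<Rightarrow> bool" where
  "is_synthesis_op f T \<longleftrightarrow> bounded_clinear T \<and> (\<forall>i. T (ell2_basis i) = f i)"

definition K_plus :: "('h \<Rightarrow> 'h \<Rightarrow> complex) \<Rightarrow> ('i \<Rightarrow> 'h) \<Rightarrow> 'i set" where
  "K_plus form f = {i. Re (form (f i) (f i)) \<ge> 0}"

definition K_minus :: "('h \<Rightarrow> 'h \<Rightarrow> complex) \<Rightarrow> ('i \<Rightarrow> 'h) \<Rightarrow> 'i set" where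
  "K_minus form f = {i. Re (form (f i) (f i)) < 0}"

text \<open>The synthesis operator \<open>T\<close> below is unique, since the finite linear combinations of the
  \<open>ell2_basis i\<close> are dense.\<close>

definition J_frame :: "('h::complex_inner \<Rightarrow> 'h \<Rightarrow> complex) \<Rightarrow> ('i \<Rightarrow> 'h) \<Rightarrow> bool" where
  "J_frame form f \<longleftrightarrow> bessel_family f \<and> (\<exists>T. is_synthesis_op f T
    \<and> max_unif_J_positive form (T ` ell2_on (K_plus form f))
    \<and> max_unif_J_negative form (T ` ell2_on (K_minus form f)))"

end

theory Submission
  imports Defs
begin

text \<open>Let \<open>P = T\<^sup>\<dagger> T\<close>, the orthogonal projection onto the complement of the null space of \<open>T\<close>.
  If \<open>Q = T P\<^sub>+ T\<^sup>\<dagger>\<close> is idempotent, then so is \<open>P P\<^sub>+ P\<close>, which forces the two orthogonal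
  projections \<open>P\<close> and \<open>P\<^sub>+\<close> to commute. Hence \<open>Q T = T P\<^sub>+\<close>, so the range and null space of \<open>Q\<close>
  are the images under \<open>T\<close> of \<open>\<ell>\<^sub>2(I\<^sub>+)\<close> and \<open>\<ell>\<^sub>2(I - I\<^sub>+)\<close>; being complementary, they are maximal.
  Conversely, the images of \<open>\<ell>\<^sub>2(K\<^sub>+)\<close> and \<open>\<ell>\<^sub>2(K\<^sub>-)\<close> meet only in \<open>0\<close>, so \<open>P\<^sub>+\<close> leaves the null space of
  \<open>T\<close> invariant; then \<open>Q T = T P\<^sub>+\<close> again, and the Friedrichs cosine is \<open>0\<close>.\<close>

section \<open>Complex inner product spaces\<close>

lemma scaleC_zero_left [simp]: "0 *\<^sub>C x = 0" for x :: "'a::complex_inner"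
  using scaleR_scaleC[of 0 x] by simp

lemma scaleC_minus_one: "(- 1) *\<^sub>C x = - x" for x :: "'a::complex_inner"
  using scaleR_scaleC[of "- 1" x] by simp

lemma scaleC_zero_right [simp]: "a *\<^sub>C 0 = 0" for a :: complex
  using scaleC_add_right[of a "0 :: 'a::complex_inner" 0] by simp

lemma scaleC_diff_right: "a *\<^sub>C (x - y) = a *\<^sub>C x - a *\<^sub>C y" for x y :: "'a::complex_inner"
  using scaleC_add_right[of a "x - y" y] by simp

lemma cinner_zero_left [simp]: "cinner 0 x = 0" for x :: "'a::complex_inner"
  using cinner_scaleC_left[of 0 x x] by simp

lemma cinner_zero_right [simp]: "cinner x 0 = 0" for x :: "'a::complex_inner"
  by (subst cinner_commute) simp

lemma cinner_minus_left: "cinner (- x) y = - cinner x y" for x y :: "'a::complex_inner"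
  using cinner_scaleC_left[of "- 1" x y] by (simp add: scaleC_minus_one)

lemma cinner_diff_left: "cinner (x - y) z = cinner x z - cinner y z"
  for x y z :: "'a::complex_inner"
  using cinner_add_left[of x "- y" z] by (simp add: cinner_minus_left)

lemma cinner_add_right: "cinner x (y + z) = cinner x y + cinner x z"
  for x y z :: "'a::complex_inner"
  by (metis cinner_add_left cinner_commute complex_cnj_add)

lemma cinner_diff_right: "cinner x (y - z) = cinner x y - cinner x z"
  for x y z :: "'a::complex_inner"
  by (metis cinner_diff_left cinner_commute complex_cnj_diff)

lemma cinner_scaleC_right: "cinner x (a *\<^sub>C y) = cnj a * cinner x y"
  for x y :: "'a::complex_inner"
  by (metis cinner_scaleC_left cinner_commute complex_cnj_mult)

lemma cinner_sum_right: "cinner x (sum f F) = (\<Sum>i\<in>F. cinner x (f i))"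
  for x :: "'a::complex_inner"
  by (induction F rule: infinite_finite_induct) (auto simp: cinner_add_right)

lemma cinner_self_eq_0 [simp]: "cinner x x = 0 \<longleftrightarrow> x = 0" for x :: "'a::complex_inner"
  by (simp add: cinner_self)

lemma cinner_eq_0_commute: "cinner x y = 0 \<longleftrightarrow> cinner y x = 0" for x y :: "'a::complex_inner"
  by (metis cinner_commute complex_cnj_zero)

lemma cinner_ext:
  fixes x y :: "'a::complex_inner"
  assumes "\<And>z. cinner z x = cinner z y"
  shows "x = y"
proof -
  have "cinner (x - y) (x - y) = 0"
    using assms[of "x - y"] by (simp add: cinner_diff_right)
  then show ?thesis by simp
qed

lemma norm_add_sq: "(norm (x + y))\<^sup>2 = (norm x)\<^sup>2 + (norm y)\<^sup>2 + 2 * Re (cinner x y)"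
  for x y :: "'a::complex_inner"
proof -
  have "complex_of_real ((norm (x + y))\<^sup>2)
      = complex_of_real ((norm x)\<^sup>2) + complex_of_real ((norm y)\<^sup>2) + (cinner x y + cnj (cinner x y))"
    unfolding cinner_self[symmetric]
    by (simp add: cinner_add_left cinner_add_right cinner_commute[of y x])
  then show ?thesis
    by (metis (no_types, lifting) Re_complex_of_real complex_add_cnj of_real_add plus_complex.simps(1))
qed

lemma norm_diff_sq: "(norm (x - y))\<^sup>2 = (norm x)\<^sup>2 + (norm y)\<^sup>2 - 2 * Re (cinner x y)"
  for x y :: "'a::complex_inner"
  using norm_add_sq[of x "- y"] cinner_minus_left[of y x]
  by (metis (no_types, opaque_lifting) add_uminus_conv_diff cinner_commute cinner_minus_left complex_cnj_minus mult_minus_right norm_minus_cancel uminus_complex.simps(1))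

text \<open>The subtracted vector is the orthogonal projection of \<open>x\<close> onto the line
  through \<open>y\<close>. The value serves both the Cauchy-Schwarz inequality and the optimality
  argument in \<open>projection_exists\<close>. For \<open>y = 0\<close> the division yields 0 and
  both sides are the squared norm of \<open>x\<close>.\<close>

lemma norm_sub_projection_sq:
  fixes x y :: "'a::complex_inner"
  shows "(norm (x - (cinner x y / complex_of_real ((norm y)\<^sup>2)) *\<^sub>C y))\<^sup>2
    = (norm x)\<^sup>2 - (cmod (cinner x y))\<^sup>2 / (norm y)\<^sup>2"
proof (cases "y = 0")
  case False
  define N where "N = (norm y)\<^sup>2"
  define c where "c = cinner x y / complex_of_real N"
  have N: "N > 0" using False by (simp add: N_def)
  have "(norm (c *\<^sub>C y))\<^sup>2 = (cmod c)\<^sup>2 * N"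
  proof -
    have "complex_of_real ((norm (c *\<^sub>C y))\<^sup>2) = c * cnj c * complex_of_real N"
      unfolding N_def cinner_self[symmetric] by (simp add: cinner_scaleC_left cinner_scaleC_right)
    also have "\<dots> = complex_of_real ((cmod c)\<^sup>2 * N)"
      by (simp add: complex_norm_square[symmetric])
    finally show ?thesis by (simp only: of_real_eq_iff)
  qed
  also have "\<dots> = (cmod (cinner x y))\<^sup>2 / N"
    using N by (simp add: c_def norm_divide power_divide power2_eq_square)
  finally have 1: "(norm (c *\<^sub>C y))\<^sup>2 = (cmod (cinner x y))\<^sup>2 / N" .
  have "cinner x (c *\<^sub>C y) = complex_of_real ((cmod (cinner x y))\<^sup>2 / N)"
    by (simp add: c_def cinner_scaleC_right complex_norm_square mult.commute
        del: of_real_power flip: N_def)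
  then have "Re (cinner x (c *\<^sub>C y)) = (cmod (cinner x y))\<^sup>2 / N"
    by (metis Re_complex_of_real)
  then show ?thesis
    using norm_diff_sq[of x "c *\<^sub>C y"] 1 by (simp add: c_def N_def)
qed simp

lemma Cauchy_Schwarz_cinner: "cmod (cinner x y) \<le> norm x * norm y" for x y :: "'a::complex_inner"
proof (cases "y = 0")
  case False
  have "0 \<le> (norm x)\<^sup>2 - (cmod (cinner x y))\<^sup>2 / (norm y)\<^sup>2"
    unfolding norm_sub_projection_sq[symmetric] by simp
  then have "(cmod (cinner x y))\<^sup>2 \<le> (norm x * norm y)\<^sup>2"
    using False by (simp add: field_simps power_mult_distrib)
  then show ?thesis by (rule power2_le_imp_le) simp
qed simp

section \<open>Subspaces, orthogonal complements and the projection theorem\<close>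

lemma csubspaceD:
  assumes "csubspace S"
  shows "0 \<in> S" "x \<in> S \<Longrightarrow> y \<in> S \<Longrightarrow> x + y \<in> S" "x \<in> S \<Longrightarrow> y \<in> S \<Longrightarrow> x - y \<in> S"
    "x \<in> S \<Longrightarrow> r *\<^sub>R x \<in> S" "x \<in> S \<Longrightarrow> c *\<^sub>C x \<in> S"
  using assms by (auto simp: csubspace_def subspace_0 subspace_add subspace_diff subspace_scale)

lemma csubspace_orth_compl: "csubspace (orth_compl S)"
  unfolding csubspace_def subspace_def orth_compl_def
  by (auto simp: cinner_add_left cinner_scaleC_left scaleR_scaleC)

lemma orth_compl_inter: "x \<in> S \<Longrightarrow> x \<in> orth_compl S \<Longrightarrow> x = 0"
  by (auto simp: orth_compl_def)

text \<open>Two candidates differ by a vector lying both in \<open>S\<close> and in its orthogonal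
  complement, hence by 0.\<close>

lemma orth_proj_eqI:
  assumes S: "csubspace S" and p: "p \<in> S" "x - p \<in> orth_compl S"
  shows "orth_proj S x = p"
  unfolding orth_proj_def
proof (rule the_equality)
  fix q assume q: "q \<in> S \<and> x - q \<in> orth_compl S"
  have "p - q \<in> S" using S p q by (simp add: csubspaceD)
  moreover have "(x - q) - (x - p) \<in> orth_compl S"
    using p q by (blast intro: csubspaceD(3)[OF csubspace_orth_compl])
  moreover have "(x - q) - (x - p) = p - q" by simp
  ultimately have "p - q = 0" using orth_compl_inter by metis
  then show "q = p" by simp
qed (use p in simp)

text \<open>A minimizing sequence for the distance from \<open>x\<close> to \<open>S\<close> is
  Cauchy by the parallelogram law. Its limit is a nearest point, and minimality makes the error
  orthogonal to \<open>S\<close>.\<close>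

lemma projection_exists:
  fixes S :: "'a::chilbert_space set"
  assumes S: "csubspace S" and "closed S"
  obtains p where "p \<in> S" "x - p \<in> orth_compl S"
proof -
  define d where "d = infdist x S"
  have ne: "S \<noteq> {}" using csubspaceD(1)[OF S] by auto
  have d_le: "d \<le> norm (x - y)" if "y \<in> S" for y
    using infdist_le[OF that, of x] by (simp add: d_def dist_norm)
  have d0: "d \<ge> 0" by (simp add: d_def infdist_nonneg)
  have "\<exists>y\<in>S. (norm (x - y))\<^sup>2 < d\<^sup>2 + inverse (real (Suc n))" for n
  proof -
    have "d < sqrt (d\<^sup>2 + inverse (real (Suc n)))"
      by (rule real_less_rsqrt) simp
    then have "\<exists>y\<in>S. dist x y < sqrt (d\<^sup>2 + inverse (real (Suc n)))"
      unfolding d_def infdist_notempty[OF ne] by (subst (asm) cINF_less_iff) (auto simp: ne)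
    then obtain y where "y \<in> S" "norm (x - y) < sqrt (d\<^sup>2 + inverse (real (Suc n)))"
      by (auto simp: dist_norm)
    then show ?thesis
      by (intro bexI[of _ y]) (metis norm_ge_zero real_sqrt_less_iff real_sqrt_abs abs_of_nonneg, simp)
  qed
  then obtain y where yS: "\<And>n. y n \<in> S"
    and y: "\<And>n. (norm (x - y n))\<^sup>2 < d\<^sup>2 + inverse (real (Suc n))" by metis
  \<comment> \<open>Parallelogram law for \<open>a\<close> and \<open>b\<close>: the midpoint of
    \<open>y n\<close> and \<open>y m\<close> lies in \<open>S\<close>, so
    \<open>norm (a + b)\<close> is at least \<open>2 * d\<close>, which leaves only the slack of the
    two squared distances for \<open>norm (a - b)\<close>.\<close>
  have par: "(norm (y n - y m))\<^sup>2 \<le> 2 * inverse (real (Suc n)) + 2 * inverse (real (Suc m))" for n m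
  proof -
    define a b where "a = x - y n" and "b = x - y m"
    have "(1/2) *\<^sub>R (y n + y m) \<in> S" using S yS by (simp add: csubspaceD)
    then have "d \<le> norm (x - (1/2) *\<^sub>R (y n + y m))" by (rule d_le)
    also have "x - (1/2) *\<^sub>R (y n + y m) = (1/2) *\<^sub>R (a + b)"
    proof -
      have "x = (1/2) *\<^sub>R (x + x)" by (metis scaleR_half_double)
      then show ?thesis
        by (simp add: a_def b_def algebra_simps flip: scaleR_add_right scaleR_diff_right)
    qed
    also have "norm \<dots> = norm (a + b) / 2" by simp
    finally have "(2 * d)\<^sup>2 \<le> (norm (a + b))\<^sup>2" using d0 by (intro power_mono) auto
    moreover have "(norm (a + b))\<^sup>2 + (norm (a - b))\<^sup>2 = 2 * (norm a)\<^sup>2 + 2 * (norm b)\<^sup>2"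
      by (simp add: norm_add_sq norm_diff_sq)
    moreover have "norm (a - b) = norm (y n - y m)"
      by (simp add: a_def b_def norm_minus_commute)
    ultimately show ?thesis
      using y[of n] y[of m] by (simp add: a_def b_def power_mult_distrib)
  qed
  have "Cauchy y"
  proof (rule CauchyI)
    fix e :: real assume e: "e > 0"
    obtain M where M: "inverse (real (Suc M)) < e\<^sup>2 / 4"
      using reals_Archimedean[of "e\<^sup>2 / 4"] e by auto
    have "norm (y n - y m) < e" if "n \<ge> M" "m \<ge> M" for n m
    proof -
      have "inverse (real (Suc n)) \<le> inverse (real (Suc M))"
        "inverse (real (Suc m)) \<le> inverse (real (Suc M))"
        using that by (auto intro!: le_imp_inverse_le)
      then have "(norm (y n - y m))\<^sup>2 < e\<^sup>2" using par[of n m] M by linarith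
      then show ?thesis using e by (simp add: power_less_imp_less_base)
    qed
    then show "\<exists>M. \<forall>m\<ge>M. \<forall>n\<ge>M. norm (y m - y n) < e" by blast
  qed
  then obtain p where lim: "y \<longlonglongrightarrow> p" by (auto simp: Cauchy_convergent_iff convergent_def)
  have pS: "p \<in> S" using \<open>closed S\<close> yS lim by (meson closed_sequentially)
  have "(norm (x - p))\<^sup>2 \<le> d\<^sup>2"
  proof (rule LIMSEQ_le)
    show "(\<lambda>n. (norm (x - y n))\<^sup>2) \<longlonglongrightarrow> (norm (x - p))\<^sup>2" by (intro tendsto_intros lim)
    show "(\<lambda>n. d\<^sup>2 + inverse (real (Suc n))) \<longlonglongrightarrow> d\<^sup>2"
      using tendsto_add[OF tendsto_const LIMSEQ_inverse_real_of_nat] by fastforce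
  qed (use y in \<open>auto intro: less_imp_le\<close>)
  then have min: "(norm (x - p))\<^sup>2 \<le> (norm (x - z))\<^sup>2" if "z \<in> S" for z
    using d_le[OF that] d0 by (meson order_trans power_mono)
  have "cinner (x - p) z = 0" if z: "z \<in> S" for z
  proof (cases "z = 0")
    case False
    \<comment> \<open>Moving from \<open>p\<close> by the best multiple of \<open>z\<close> lowers
      the squared distance by exactly the quotient in \<open>norm_sub_projection_sq\<close>, so
      minimality forces the inner product to vanish.\<close>
    define c where "c = cinner (x - p) z / complex_of_real ((norm z)\<^sup>2)"
    have "p + c *\<^sub>C z \<in> S" using S pS z by (simp add: csubspaceD)
    from min[OF this] have "(norm (x - p))\<^sup>2 \<le> (norm ((x - p) - c *\<^sub>C z))\<^sup>2"
      by (simp only: diff_diff_eq)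
    then have "(cmod (cinner (x - p) z))\<^sup>2 / (norm z)\<^sup>2 \<le> 0"
      unfolding c_def norm_sub_projection_sq by simp
    then show ?thesis using False by (simp add: divide_le_0_iff)
  qed simp
  then show ?thesis using that pS by (auto simp: orth_compl_def)
qed

section \<open>The open mapping theorem\<close>

text \<open>Baire category gives a ball inside the closure of the image of some ball. Differences
  recentre it at 0 and scaling extends it to all \<open>y\<close>. Because of the closure, the
  preimages are only approximate.\<close>

lemma open_mapping_approx:
  fixes f :: "'a::banach \<Rightarrow> 'b::banach"
  assumes "bounded_linear f" "surj f"
  obtains K where "K \<ge> 0" "\<And>y. \<exists>x. norm x \<le> K * norm y \<and> norm (y - f x) \<le> norm y / 2"
proof -
  interpret bounded_linear f by fact
  define F where "F n = closure (f ` cball 0 (real n))" for n :: nat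
  have "\<exists>n. interior (F n) \<noteq> {}"
  proof (rule ccontr)
    assume "\<not> ?thesis"
    then have "euclidean interior_of \<Union>(range F) = {}"
      by (intro Baire_category_alt)
        (auto simp: F_def completely_metrizable_space_euclidean interior_of_eq_empty)
    moreover have "\<Union>(range F) = UNIV"
    proof (intro equalityI subsetI UNIV_I)
      fix y
      obtain x where "y = f x" using \<open>surj f\<close> by blast
      moreover obtain n where "norm x \<le> real n" using real_arch_simple by blast
      ultimately have "y \<in> F n"
        unfolding F_def using closure_subset by (fastforce simp: dist_norm)
      then show "y \<in> \<Union>(range F)" by blast
    qed
    ultimately show False by simp
  qed
  then obtain n y0 r where r: "r > 0" "ball y0 r \<subseteq> F n"
    by (meson all_not_in_conv mem_interior)
  \<comment> \<open>Write \<open>z\<close> as the difference of \<open>y0 + z\<close> and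
    \<open>y0\<close>, both in \<open>F n\<close>; approximating each within \<open>e / 2\<close>
    doubles the norm bound on the preimage.\<close>
  have approx: "\<exists>x. norm x \<le> 2 * real n \<and> norm (z - f x) < e" if "norm z < r" "e > 0" for z e
  proof -
    have "y0 + z \<in> F n" "y0 \<in> F n" using r that by (auto simp: subset_iff dist_norm)
    moreover have "\<exists>a. norm a \<le> real n \<and> norm (f a - u) < e / 2" if "u \<in> F n" for u
    proof -
      have "e / 2 > 0" using \<open>e > 0\<close> by simp
      with that obtain v where "v \<in> f ` cball 0 (real n)" "dist v u < e / 2"
        unfolding F_def closure_approachable by blast
      then show ?thesis by (auto simp: dist_norm)
    qed
    ultimately obtain a b where a: "norm a \<le> real n" "norm (f a - (y0 + z)) < e / 2"
      and b: "norm b \<le> real n" "norm (f b - y0) < e / 2"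
      by meson
    have "norm (a - b) \<le> 2 * real n" using norm_triangle_ineq4[of a b] a b by linarith
    moreover have "z - f (a - b) = (f b - y0) - (f a - (y0 + z))" by (simp add: diff)
    then have "norm (z - f (a - b)) < e"
      using norm_triangle_ineq4[of "f b - y0" "f a - (y0 + z)"] a b
      by (simp only:)
    ultimately show ?thesis by blast
  qed
  \<comment> \<open>Rescaling \<open>y\<close> to norm \<open>r / 2\<close> and allowing an error of
    \<open>r / 4\<close> gives relative error 1/2; undoing the scaling turns the bound
    \<open>2 * real n\<close> into \<open>K * norm y\<close>.\<close>
  define K where "K = 4 * real n / r"
  have "\<exists>x. norm x \<le> K * norm y \<and> norm (y - f x) \<le> norm y / 2" for y
  proof (cases "y = 0")
    case True
    then show ?thesis by (intro exI[of _ 0]) (simp add: zero)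
  next
    case False
    define t where "t = r / (2 * norm y)"
    have t: "t > 0" "t * norm y = r / 2" using False r by (auto simp: t_def)
    then obtain x where x: "norm x \<le> 2 * real n" "norm (t *\<^sub>R y - f x) < r / 4"
      using approx[of "t *\<^sub>R y" "r / 4"] r by auto
    have "norm (inverse t *\<^sub>R x) \<le> inverse t * (2 * real n)"
      using x t by (simp add: mult_left_mono)
    also have "\<dots> = K * norm y" using False r by (simp add: K_def t_def field_simps)
    finally have 1: "norm (inverse t *\<^sub>R x) \<le> K * norm y" .
    have "y - f (inverse t *\<^sub>R x) = inverse t *\<^sub>R (t *\<^sub>R y - f x)"
      using t by (simp add: scaleR scaleR_diff_right)
    then have "norm (y - f (inverse t *\<^sub>R x)) = inverse t * norm (t *\<^sub>R y - f x)"
      using t by simp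
    also have "\<dots> \<le> inverse t * (r / 4)" using x t by (intro mult_left_mono) auto
    also have "\<dots> = norm y / 2" using False r by (simp add: t_def field_simps)
    finally show ?thesis using 1 by blast
  qed
  moreover have "K \<ge> 0" using r by (simp add: K_def)
  ultimately show ?thesis using that by blast
qed

text \<open>Iterating the approximate solution on the residual halves the residual each time. The
  corrections are dominated by a geometric series, so they sum to an exact preimage.\<close>

lemma open_mapping_bound:
  fixes f :: "'a::banach \<Rightarrow> 'b::banach"
  assumes "bounded_linear f" "surj f"
  obtains C where "\<And>y. \<exists>x. f x = y \<and> norm x \<le> C * norm y"
proof -
  interpret bounded_linear f by fact
  obtain K where K: "K \<ge> 0"
    and "\<And>y. \<exists>x. norm x \<le> K * norm y \<and> norm (y - f x) \<le> norm y / 2"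
    using open_mapping_approx[OF assms] by blast
  then obtain g where g: "\<And>y. norm (g y) \<le> K * norm y" "\<And>y. norm (y - f (g y)) \<le> norm y / 2"
    by metis
  have "\<exists>x. f x = y \<and> norm x \<le> (2 * K) * norm y" for y
  proof -
    \<comment> \<open>\<open>res k\<close> is the residual after \<open>k\<close> corrections. The
      images of the corrections are its successive differences, so their series telescopes to
      \<open>y\<close>.\<close>
    define res where "res k = ((\<lambda>z. z - f (g z)) ^^ k) y" for k
    have res_Suc: "res (Suc k) = res k - f (g (res k))" for k by (simp add: res_def)
    have res_le: "norm (res k) \<le> norm y * (1/2) ^ k" for k
    proof (induction k)
      case (Suc k)
      then show ?case using g(2)[of "res k"] by (simp add: res_Suc)
    qed (simp add: res_def)
    have gb: "norm (g (res k)) \<le> K * norm y * (1/2) ^ k" for k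
      using g(1)[of "res k"] mult_left_mono[OF res_le[of k] K] by (simp add: mult.assoc)
    have geo: "(\<lambda>k. K * norm y * (1/2) ^ k) sums (K * norm y * 2)"
      using geometric_sums[of "1/2 :: real"] by (intro sums_mult) simp
    have sn: "summable (\<lambda>k. norm (g (res k)))"
      by (rule summable_comparison_test'[OF sums_summable[OF geo], of 0]) (use gb in auto)
    then have sm: "summable (\<lambda>k. g (res k))" by (rule summable_norm_cancel)
    have "norm (\<Sum>k. g (res k)) \<le> (\<Sum>k. norm (g (res k)))" by (rule summable_norm[OF sn])
    also have "\<dots> \<le> K * norm y * 2"
      using suminf_le[OF gb sn sums_summable[OF geo]] sums_unique[OF geo] by simp
    finally have nb: "norm (\<Sum>k. g (res k)) \<le> (2 * K) * norm y" by (simp add: mult_ac)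
    have "(\<lambda>k. f (g (res k))) sums f (\<Sum>k. g (res k))"
      by (rule sums[OF summable_sums[OF sm]])
    moreover have "(\<lambda>k. f (g (res k))) sums y"
    proof -
      have "res \<longlonglongrightarrow> 0"
      proof (rule Lim_null_comparison)
        show "(\<lambda>k. norm y * (1/2) ^ k) \<longlonglongrightarrow> 0"
          by (intro tendsto_mult_right_zero LIMSEQ_realpow_zero) auto
      qed (use res_le in auto)
      from telescope_sums'[OF this] show ?thesis by (simp add: res_Suc) (simp add: res_def)
    qed
    ultimately have "f (\<Sum>k. g (res k)) = y" by (rule sums_unique2)
    then show ?thesis using nb by blast
  qed
  then show ?thesis using that by blast
qed

section \<open>The Moore-Penrose inverse of a surjection\<close>

lemma bounded_clinearD:
  assumes "bounded_clinear A"
  shows "bounded_linear A" "A (x + y) = A x + A y" "A (x - y) = A x - A y" "A 0 = 0"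
    "A (c *\<^sub>C x) = c *\<^sub>C A x" "A (sum h F) = (\<Sum>i\<in>F. A (h i))"
  using assms
  by (auto simp: bounded_clinear_def bounded_linear.linear linear_add linear_diff linear_0 linear_sum)

lemma bounded_clinear_compose:
  "bounded_clinear A \<Longrightarrow> bounded_clinear B \<Longrightarrow> bounded_clinear (A \<circ> B)"
  unfolding bounded_clinear_def o_def by (auto intro: bounded_linear_compose)

lemma csubspace_null_space: "bounded_clinear A \<Longrightarrow> csubspace (null_space A)"
  unfolding csubspace_def subspace_def null_space_def
  by (auto simp: bounded_clinearD scaleR_scaleC)

lemma closed_null_space:
  assumes "bounded_clinear A"
  shows "closed (null_space A)"
proof -
  have "continuous_on UNIV A"
    using bounded_linear.continuous_on[OF bounded_clinearD(1)[OF assms] continuous_on_id] by simp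
  then have "closed (A -` {0})" by (intro closed_vimage) auto
  then show ?thesis by (simp add: null_space_def vimage_def)
qed

text \<open>The right inverse property gives \<open>X A Y A = X A\<close> and
  \<open>Y A X A = Y A\<close>. Taking adjoints in the first and comparing with the second yields
  \<open>X A = Y A\<close>, and surjectivity cancels \<open>A\<close>.\<close>

lemma penrose_unique_of_surj:
  assumes A: "surj A" and X: "A \<circ> X = id" "selfadjoint_op (X \<circ> A)"
    and Y: "A \<circ> Y = id" "selfadjoint_op (Y \<circ> A)"
  shows "X = Y"
proof -
  have AX: "A (X u) = u" "A (Y u) = u" for u using X(1) Y(1) by (metis comp_apply id_apply)+
  have "X (A u) = Y (A u)" for u
  proof (rule cinner_ext)
    fix z
    have "cinner z (X (A u)) = cinner (X (A z)) u"
      using X(2) by (simp add: selfadjoint_op_def)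
    also have "\<dots> = cinner (X (A (Y (A z)))) u" by (simp add: AX)
    also have "\<dots> = cinner (Y (A z)) (X (A u))"
      using X(2) by (simp add: selfadjoint_op_def)
    also have "\<dots> = cinner z (Y (A (X (A u))))"
      using Y(2) by (simp add: selfadjoint_op_def)
    also have "\<dots> = cinner z (Y (A u))" by (simp add: AX)
    finally show "cinner z (X (A u)) = cinner z (Y (A u))" .
  qed
  then show ?thesis using A by (metis ext surjD)
qed

text \<open>\<open>X y\<close> is the unique preimage of \<open>y\<close> orthogonal to the null
  space. Uniqueness gives linearity, and the open mapping bound gives boundedness.\<close>

lemma penrose_exists_of_surj:
  fixes A :: "'a::chilbert_space \<Rightarrow> 'b::chilbert_space"
  assumes A: "bounded_clinear A" "surj A"
  obtains X where "bounded_clinear X" "A \<circ> X = id" "selfadjoint_op (X \<circ> A)"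
proof -
  let ?N = "null_space A"
  note N = csubspace_null_space[OF A(1)] closed_null_space[OF A(1)]
  note lin = bounded_clinearD[OF A(1)]
  note orth = csubspaceD[OF csubspace_orth_compl[of ?N]]
  obtain C where C: "\<And>y. \<exists>x. A x = y \<and> norm x \<le> C * norm y"
    using open_mapping_bound[OF lin(1) A(2)] by blast
  have "\<exists>p \<in> orth_compl ?N. A p = y \<and> norm p \<le> C * norm y" for y
  proof -
    obtain x where x: "A x = y" "norm x \<le> C * norm y" using C by blast
    obtain n where n: "n \<in> ?N" "x - n \<in> orth_compl ?N"
      using projection_exists[OF N] by blast
    \<comment> \<open>By Pythagoras, removing the null space component does not increase the norm,
      so the bound \<open>C\<close> survives.\<close>
    have "cinner (x - n) n = 0" using n by (auto simp: orth_compl_def)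
    then have "(norm x)\<^sup>2 = (norm (x - n))\<^sup>2 + (norm n)\<^sup>2"
      using norm_add_sq[of "x - n" n] by simp
    then have "norm (x - n) \<le> norm x" by (simp add: power2_le_imp_le)
    moreover have "A (x - n) = y" using x n by (simp add: lin null_space_def)
    ultimately show ?thesis using n x by (intro bexI[of _ "x - n"]) auto
  qed
  then obtain X where X: "\<And>y. X y \<in> orth_compl ?N" "\<And>y. A (X y) = y"
    "\<And>y. norm (X y) \<le> C * norm y" by metis
  have uniq: "p = X y" if "p \<in> orth_compl ?N" "A p = y" for p y
  proof -
    have "p - X y \<in> orth_compl ?N" using that X by (simp add: orth)
    moreover have "p - X y \<in> ?N" using that X by (simp add: null_space_def lin)
    ultimately have "p - X y = 0" by (intro orth_compl_inter)
    then show ?thesis by simp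
  qed
  have "X (y + z) = X y + X z" for y z
    using uniq[of "X y + X z" "y + z"] X by (simp add: orth lin)
  moreover have sC: "X (c *\<^sub>C y) = c *\<^sub>C X y" for c y
    using uniq[of "c *\<^sub>C X y" "c *\<^sub>C y"] X by (simp add: orth lin)
  ultimately have "bounded_linear X"
    using X(3) by (intro bounded_linear_intro[where K = C]) (auto simp: scaleR_scaleC mult.commute)
  then have bc: "bounded_clinear X" using sC by (simp add: bounded_clinear_def)
  have "cinner (X (A x)) y = cinner x (X (A y))" for x y
  proof -
    have N: "u - X (A u) \<in> ?N" for u using X by (simp add: null_space_def lin)
    have "cinner (X (A x)) (y - X (A y)) = 0" using X(1) N by (auto simp: orth_compl_def)
    moreover have "cinner (x - X (A x)) (X (A y)) = 0"
      using X(1) N by (subst cinner_eq_0_commute) (auto simp: orth_compl_def)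
    ultimately show ?thesis by (simp add: cinner_diff_left cinner_diff_right)
  qed
  then have "selfadjoint_op (X \<circ> A)" by (simp add: selfadjoint_op_def)
  moreover have "A \<circ> X = id" using X by auto
  ultimately show ?thesis using that bc by blast
qed

text \<open>Replaces the \<open>THE\<close> in the definition by usable facts: surjectivity cancels
  \<open>A\<close> on the right of \<open>A Y A = A\<close>, so every solution of the Penrose
  equations is a right inverse and uniqueness applies.\<close>

lemma moore_penrose_of_surj:
  fixes A :: "'a::chilbert_space \<Rightarrow> 'b::chilbert_space"
  assumes A: "bounded_clinear A" "surj A"
  shows "bounded_clinear (moore_penrose A)" "A (moore_penrose A y) = y"
    "selfadjoint_op (moore_penrose A \<circ> A)"
proof -
  obtain X where X: "bounded_clinear X" "A \<circ> X = id" "selfadjoint_op (X \<circ> A)"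
    using penrose_exists_of_surj[OF A] by blast
  have "moore_penrose A = X"
    unfolding moore_penrose_def
  proof (rule the_equality)
    show "bounded_clinear X \<and> A \<circ> X \<circ> A = A \<and> X \<circ> A \<circ> X = X
        \<and> selfadjoint_op (A \<circ> X) \<and> selfadjoint_op (X \<circ> A)"
      using X by (simp add: comp_assoc) (simp add: selfadjoint_op_def)
  next
    fix Y assume Y: "bounded_clinear Y \<and> A \<circ> Y \<circ> A = A \<and> Y \<circ> A \<circ> Y = Y
        \<and> selfadjoint_op (A \<circ> Y) \<and> selfadjoint_op (Y \<circ> A)"
    have "A \<circ> Y = id"
    proof
      fix y
      obtain x where "y = A x" using A(2) by blast
      then show "(A \<circ> Y) y = id y" using Y by (metis comp_apply id_apply)
    qed
    then show "Y = X" using penrose_unique_of_surj[OF A(2)] X Y by blast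
  qed
  moreover have "A (X y) = y" using X(2) by (metis comp_apply id_apply)
  ultimately show "bounded_clinear (moore_penrose A)" "A (moore_penrose A y) = y"
    "selfadjoint_op (moore_penrose A \<circ> A)"
    using X by simp_all
qed

section \<open>Commuting orthogonal projections\<close>

text \<open>The hypothesis reads \<open>R P = P R P\<close>. The right side is its own adjoint,
  hence so is \<open>R P\<close>, and that adjoint is \<open>P R\<close>.\<close>

lemma selfadjoint_commute_of_compression:
  assumes P: "selfadjoint_op P" and R: "selfadjoint_op R"
    and PR: "\<And>x. R (P x) = P (R (P x))"
  shows "P (R x) = R (P x)"
proof (rule cinner_ext)
  fix z
  have "cinner z (P (R x)) = cinner (R (P z)) x"
    using P R by (simp add: selfadjoint_op_def)
  also have "\<dots> = cinner (P (R (P z))) x" using PR by simp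
  also have "\<dots> = cinner z (P (R (P x)))" using P R by (simp add: selfadjoint_op_def)
  finally show "cinner z (P (R x)) = cinner z (R (P x))" by (simp flip: PR)
qed

text \<open>When the compression \<open>P R P\<close> is idempotent, the range of \<open>P\<close>
  splits into vectors that \<open>R\<close> fixes and vectors that \<open>R\<close>
  annihilates.\<close>

lemma projections_commute_of_idem_compression:
  fixes P R :: "'a::complex_inner \<Rightarrow> 'a"
  assumes P: "selfadjoint_op P" "\<And>x. P (P x) = P x" "\<And>x y. P (x - y) = P x - P y"
    and R: "selfadjoint_op R" "\<And>x. R (R x) = R x" "\<And>x y. R (x - y) = R x - R y"
    and idem: "\<And>x. P (R (P (R (P x)))) = P (R (P x))"
  shows "P (R x) = R (P x)"
proof (rule selfadjoint_commute_of_compression[OF P(1) R(1)])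
  have Rsq: "cinner (R z) (R z) = cinner (R z) z" for z
    using R(1,2) by (metis selfadjoint_op_def)
  have PR: "cinner (P (R z)) z = cinner (R z) z" if "P z = z" for z
    using P(1) that by (simp add: selfadjoint_op_def)
  fix x
  \<comment> \<open>This splits \<open>P x\<close> into eigenvectors of the compression for the
    eigenvalues 1 and 0. For a projection \<open>R\<close>, the values of
    \<open>cinner (R z) z\<close> then force \<open>R v = v\<close> and
    \<open>R w = 0\<close>.\<close>
  define v w where "v = P (R (P x))" and "w = P x - v"
  have v: "P v = v" "P (R v) = v" using P(2) idem by (simp_all add: v_def)
  have w: "P w = w" "P (R w) = 0"
    using v by (simp_all add: w_def P R(3)) (simp add: v_def)
  have "cinner (v - R v) (v - R v) = 0"
  proof -
    have "cinner (R v) v = cinner v v" using PR[OF v(1)] v(2) by simp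
    moreover have "cinner v (R v) = cinner (R v) v" using R(1) by (simp add: selfadjoint_op_def)
    ultimately show ?thesis by (simp add: cinner_diff_left cinner_diff_right Rsq)
  qed
  then have "R v = v" by (metis cinner_self_eq_0 eq_iff_diff_eq_0)
  moreover have "R w = 0" using PR[OF w(1)] w(2) Rsq[of w] by simp
  ultimately have "R (P x) = v" using R(3)[of "P x" v] by (simp add: w_def)
  then show "R (P x) = P (R (P x))" by (simp add: v_def)
qed

text \<open>\<open>R\<close> is the orthogonal projection onto \<open>L\<close>. For
  \<open>x\<close> in \<open>ominus S L\<close>, the vector \<open>R x\<close> lies in the
  intersection of \<open>S\<close> and \<open>L\<close>, to which \<open>x\<close> is orthogonal;
  hence \<open>R x = 0\<close> and \<open>x\<close> is orthogonal to all of
  \<open>L\<close>.\<close>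

lemma friedrichs_cos_eq_0_of_invariant:
  fixes S L :: "'a::complex_inner set"
  assumes R: "selfadjoint_op R" "\<And>x. R x \<in> L" "\<And>y. y \<in> L \<Longrightarrow> R y = y"
    and inv: "\<And>x. x \<in> S \<Longrightarrow> R x \<in> S"
  shows "friedrichs_cos S L = 0"
proof -
  define V where "V = {cmod (cinner x y) |x y.
      x \<in> ominus S L \<and> norm x = 1 \<and> y \<in> ominus L S \<and> norm y = 1}"
  have "cinner x y = 0" if x: "x \<in> ominus S L" and y: "y \<in> ominus L S" for x y
  proof -
    have xS: "x \<in> S" "x \<in> orth_compl (S \<inter> L)" and yL: "y \<in> L"
      using x y by (auto simp: ominus_def)
    have "R x \<in> S \<inter> L" using inv[OF xS(1)] R(2) by blast
    then have "cinner x (R x) = 0" using xS(2) by (auto simp: orth_compl_def)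
    then have "cinner (R x) (R x) = 0"
      using R by (metis selfadjoint_op_def)
    then have "R x = 0" by simp
    moreover have "cinner x y = cinner (R x) y" using R yL by (metis selfadjoint_op_def)
    ultimately show ?thesis by simp
  qed
  then have "V \<subseteq> {0}" by (auto simp: V_def)
  \<comment> \<open>The empty case falls under the default value 0 in the definition of the
    cosine.\<close>
  then consider "V = {}" | "V = {0}" by blast
  then show ?thesis unfolding friedrichs_cos_def V_def[symmetric] Let_def by cases auto
qed

section \<open>Coordinate projections of \<open>\<ell>\<^sub>2\<close>\<close>

text \<open>Explicit coordinate form of the orthogonal projection onto \<open>ell2_on K\<close>;
  \<open>orth_proj_ell2_on\<close> identifies the two.\<close>

lift_definition ell2_restrict :: "'i set \<Rightarrow> 'i ell2 \<Rightarrow> 'i ell2"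
  is "\<lambda>K x i. if i \<in> K then x i else 0"
  subgoal for K x
    by (rule summable_on_comparison_test[where f = "\<lambda>i. (cmod (x i))\<^sup>2"]) auto
  done

lemma ell2_eqI: "(\<And>i. ell2_nth x i = ell2_nth y i) \<Longrightarrow> x = y"
  by (metis ell2_nth_inject ext)

lemma ell2_restrict_in: "ell2_restrict K x \<in> ell2_on K"
  by (simp add: ell2_on_def ell2_restrict.rep_eq)

lemma ell2_restrict_id: "x \<in> ell2_on K \<Longrightarrow> ell2_restrict K x = x"
  by (rule ell2_eqI) (auto simp: ell2_on_def ell2_restrict.rep_eq)

lemma ell2_restrict_add: "ell2_restrict K (x + y) = ell2_restrict K x + ell2_restrict K y"
  by (rule ell2_eqI) (simp add: ell2_restrict.rep_eq plus_ell2.rep_eq)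

lemma ell2_restrict_diff: "ell2_restrict K (x - y) = ell2_restrict K x - ell2_restrict K y"
  by (rule ell2_eqI) (simp add: ell2_restrict.rep_eq minus_ell2.rep_eq)

lemma ell2_restrict_scaleC: "ell2_restrict K (c *\<^sub>C x) = c *\<^sub>C ell2_restrict K x"
  by (rule ell2_eqI) (simp add: ell2_restrict.rep_eq scaleC_ell2.rep_eq)

lemma ell2_restrict_split: "x = ell2_restrict K x + ell2_restrict (- K) x"
  by (rule ell2_eqI) (simp add: ell2_restrict.rep_eq plus_ell2.rep_eq)

lemma ell2_restrict_compl_on: "x \<in> ell2_on (- K) \<Longrightarrow> ell2_restrict K x = 0"
  by (rule ell2_eqI) (auto simp: ell2_on_def ell2_restrict.rep_eq zero_ell2.rep_eq)

lemma csubspace_ell2_on: "csubspace (ell2_on K)"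
  unfolding csubspace_def subspace_def ell2_on_def
  by (auto simp: plus_ell2.rep_eq zero_ell2.rep_eq scaleC_ell2.rep_eq scaleR_ell2.rep_eq)

lemma ell2_on_mono: "K \<subseteq> K' \<Longrightarrow> ell2_on K \<subseteq> ell2_on K'"
  by (auto simp: ell2_on_def)

lemma cinner_ell2_disjoint:
  assumes "x \<in> ell2_on K" "y \<in> ell2_on (- K)"
  shows "cinner x y = 0"
  unfolding cinner_ell2_def using assms by (intro infsum_0) (auto simp: ell2_on_def)

lemma selfadjoint_ell2_restrict: "selfadjoint_op (ell2_restrict K)"
  unfolding selfadjoint_op_def
proof (intro allI)
  fix x y
  have "cinner (ell2_restrict K x) (ell2_restrict (- K) y) = 0"
    "cinner (ell2_restrict (- K) x) (ell2_restrict K y) = 0"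
    using cinner_ell2_disjoint[of "ell2_restrict K x" K "ell2_restrict (- K) y"]
      cinner_ell2_disjoint[of "ell2_restrict (- K) x" "- K" "ell2_restrict K y"]
    by (simp_all add: ell2_restrict_in)
  then show "cinner (ell2_restrict K x) y = cinner x (ell2_restrict K y)"
    by (metis (no_types, lifting) add.right_neutral cinner_add_left cinner_add_right
        ell2_restrict_split)
qed

lemma orth_proj_ell2_on: "orth_proj (ell2_on K) = ell2_restrict K"
proof
  fix x
  have "x - ell2_restrict K x = ell2_restrict (- K) x"
    using ell2_restrict_split[of x K] by (metis add_diff_cancel_left')
  then have "x - ell2_restrict K x \<in> orth_compl (ell2_on K)"
    unfolding orth_compl_def
    using cinner_ell2_disjoint[OF ell2_restrict_in[of "- K" x]] by auto
  then show "orth_proj (ell2_on K) x = ell2_restrict K x"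
    by (intro orth_proj_eqI csubspace_ell2_on ell2_restrict_in)
qed

lemma ell2_restrict_pythagoras:
  "(norm x)\<^sup>2 = (norm (ell2_restrict K x))\<^sup>2 + (norm (ell2_restrict (- K) x))\<^sup>2"
proof -
  have "cinner (ell2_restrict K x) (ell2_restrict (- K) x) = 0"
    by (rule cinner_ell2_disjoint[OF ell2_restrict_in ell2_restrict_in])
  then show ?thesis
    using norm_add_sq[of "ell2_restrict K x" "ell2_restrict (- K) x"]
    by (simp flip: ell2_restrict_split)
qed

lemma bounded_clinear_ell2_restrict: "bounded_clinear (ell2_restrict K)"
  unfolding bounded_clinear_def
proof (intro conjI bounded_linear_intro[where K = 1] allI)
  fix x :: "'a ell2"
  have "(norm (ell2_restrict K x))\<^sup>2 \<le> (norm x)\<^sup>2" using ell2_restrict_pythagoras[of x K] by simp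
  then have "norm (ell2_restrict K x) \<le> norm x" by (rule power2_le_imp_le) simp
  then show "norm (ell2_restrict K x) \<le> norm x * 1" by simp
qed (simp_all only: ell2_restrict_add ell2_restrict_scaleC scaleR_scaleC)

section \<open>Finite truncations and synthesis operators\<close>

lemma norm_ell2_restrict_finite:
  assumes "finite F"
  shows "(norm (ell2_restrict F x))\<^sup>2 = (\<Sum>i\<in>F. (cmod (ell2_nth x i))\<^sup>2)"
proof -
  have "(norm (ell2_restrict F x))\<^sup>2 = (\<Sum>\<^sub>\<infinity>i\<in>F. (cmod (ell2_nth x i))\<^sup>2)"
    unfolding ell2_norm_sq by (rule infsum_cong_neutral) (auto simp: ell2_restrict.rep_eq)
  then show ?thesis using assms by simp
qed

lemma ell2_nth_sum: "ell2_nth (sum h F) j = (\<Sum>i\<in>F. ell2_nth (h i) j)"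
  by (induction F rule: infinite_finite_induct) (auto simp: zero_ell2.rep_eq plus_ell2.rep_eq)

lemma ell2_nth_basis_sum:
  assumes "finite F"
  shows "ell2_nth (\<Sum>i\<in>F. c i *\<^sub>C ell2_basis i) j = (if j \<in> F then c j else 0)"
proof -
  have "ell2_nth (\<Sum>i\<in>F. c i *\<^sub>C ell2_basis i) j = (\<Sum>i\<in>F. if j = i then c i else 0)"
    unfolding ell2_nth_sum by (intro sum.cong) (auto simp: scaleC_ell2.rep_eq ell2_basis.rep_eq)
  then show ?thesis using assms by simp
qed

lemma ell2_restrict_finite_eq_sum:
  "finite F \<Longrightarrow> ell2_restrict F x = (\<Sum>i\<in>F. ell2_nth x i *\<^sub>C ell2_basis i)"
  by (rule ell2_eqI) (simp add: ell2_nth_basis_sum ell2_restrict.rep_eq)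

lemma ell2_restrict_tail_small:
  assumes "e > 0"
  obtains F where "finite F" "norm (ell2_restrict (- F) x) < e"
proof -
  have "((\<lambda>i. (cmod (ell2_nth x i))\<^sup>2) has_sum (norm x)\<^sup>2) UNIV"
    unfolding ell2_norm_sq by (rule has_sum_infsum[OF ell2_summable])
  moreover have "e\<^sup>2 > 0" using assms by simp
  ultimately have "\<forall>\<^sub>F F in finite_subsets_at_top UNIV.
      dist (\<Sum>i\<in>F. (cmod (ell2_nth x i))\<^sup>2) ((norm x)\<^sup>2) < e\<^sup>2"
    unfolding has_sum_def by (rule tendstoD)
  then obtain F where F: "finite F" "dist (\<Sum>i\<in>F. (cmod (ell2_nth x i))\<^sup>2) ((norm x)\<^sup>2) < e\<^sup>2"
    unfolding eventually_finite_subsets_at_top by blast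
  then have "(norm (ell2_restrict (- F) x))\<^sup>2 < e\<^sup>2"
    using ell2_restrict_pythagoras[of x F] norm_ell2_restrict_finite[OF F(1), of x] F(2)
    by (simp add: dist_real_def)
  then have "norm (ell2_restrict (- F) x) < e" using assms by (simp add: power_less_imp_less_base)
  then show ?thesis using that F by blast
qed

text \<open>Linearity kills every finite truncation of \<open>x\<close>, and boundedness makes the
  contribution of the tail arbitrarily small.\<close>

lemma vanishes_on_ell2_on:
  fixes A :: "'i ell2 \<Rightarrow> 'h::complex_inner"
  assumes A: "bounded_clinear A" and 0: "\<And>i. i \<in> K \<Longrightarrow> A (ell2_basis i) = 0" and x: "x \<in> ell2_on K"
  shows "A x = 0"
proof -
  note lin = bounded_clinearD[OF A]
  obtain B where B: "B > 0" "\<And>x. norm (A x) \<le> norm x * B"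
    using bounded_linear.pos_bounded[OF lin(1)] by blast
  have "norm (A x) \<le> 0 + e" if "e > 0" for e
  proof -
    have "e / B > 0" using that B by simp
    then obtain F where F: "finite F" "norm (ell2_restrict (- F) x) < e / B"
      by (rule ell2_restrict_tail_small)
    have "A (ell2_nth x i *\<^sub>C ell2_basis i) = 0" for i
      using 0[of i] x by (cases "i \<in> K") (auto simp: ell2_on_def lin(4,5))
    then have "A (ell2_restrict F x) = 0"
      by (simp add: ell2_restrict_finite_eq_sum F lin(6))
    then have "A x = A (ell2_restrict (- F) x)"
      using lin(2)[of "ell2_restrict F x" "ell2_restrict (- F) x"]
      by (simp flip: ell2_restrict_split)
    then have "norm (A x) \<le> norm (ell2_restrict (- F) x) * B" using B by simp
    also have "\<dots> \<le> e" using F(2) B(1) by (simp add: field_simps)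
    finally show ?thesis by simp
  qed
  then have "norm (A x) \<le> 0" by (rule field_le_epsilon)
  then show ?thesis by simp
qed

text \<open>Needed because \<open>J_frame\<close> quantifies over its own synthesis operator, which
  must be identified with the given \<open>T\<close>.\<close>

lemma synthesis_op_unique:
  assumes "is_synthesis_op f T" "is_synthesis_op f T'"
  shows "T = T'"
proof
  fix x
  note T = assms[unfolded is_synthesis_op_def]
  have "bounded_clinear (\<lambda>x. T x - T' x)"
    using T by (auto simp: bounded_clinear_def scaleC_diff_right intro: bounded_linear_sub)
  from vanishes_on_ell2_on[OF this, of UNIV x] have "T x - T' x = 0"
    using T by (auto simp: ell2_on_def)
  then show "T x = T' x" by simp
qed

lemma bessel_family_of_bounded:
  fixes T :: "'i ell2 \<Rightarrow> 'h::complex_inner"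
  assumes T: "bounded_clinear T"
  shows "bessel_family (\<lambda>i. T (ell2_basis i))"
proof -
  note lin = bounded_clinearD[OF T]
  obtain B where B: "B > 0" "\<And>x. norm (T x) \<le> norm x * B"
    using bounded_linear.pos_bounded[OF lin(1)] by blast
  have fin: "(\<Sum>i\<in>F. (cmod (cinner g (T (ell2_basis i))))\<^sup>2) \<le> B\<^sup>2 * (norm g)\<^sup>2"
    if F: "finite F" for F g
  proof -
    \<comment> \<open>Duality: \<open>a\<close> is the truncated vector of frame coefficients of
      \<open>g\<close>, so pairing \<open>g\<close> with \<open>T a\<close> gives the squared norm
      of \<open>a\<close>. Cauchy-Schwarz and cancelling one factor \<open>norm a\<close> yield the
      Bessel bound.\<close>
    define c where "c i = cinner g (T (ell2_basis i))" for i
    define a where "a = (\<Sum>i\<in>F. c i *\<^sub>C ell2_basis i)"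
    define s where "s = (\<Sum>i\<in>F. (cmod (c i))\<^sup>2)"
    have "ell2_restrict F a = a"
      by (rule ell2_restrict_id) (simp add: a_def ell2_on_def ell2_nth_basis_sum F)
    then have na: "(norm a)\<^sup>2 = s"
      using norm_ell2_restrict_finite[OF F, of a] by (simp add: s_def a_def ell2_nth_basis_sum F)
    have "cinner g (T a) = (\<Sum>i\<in>F. cnj (c i) * c i)"
      by (simp add: a_def lin cinner_sum_right cinner_scaleC_right c_def)
    also have "\<dots> = complex_of_real s"
      unfolding s_def of_real_sum by (intro sum.cong refl) (simp only: complex_norm_square mult.commute)
    finally have "s \<le> norm g * norm (T a)"
      using Cauchy_Schwarz_cinner[of g "T a"] by simp
    also have "\<dots> \<le> norm g * (norm a * B)" by (intro mult_left_mono B) auto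
    finally have *: "norm a * norm a \<le> (B * norm g) * norm a"
      by (simp add: na[symmetric] power2_eq_square mult_ac)
    have "norm a \<le> B * norm g"
    proof (cases "a = 0")
      case True then show ?thesis using B(1) by simp
    next
      case False
      with * show ?thesis by (intro mult_right_le_imp_le[OF *]) simp
    qed
    then have "(norm a)\<^sup>2 \<le> (B * norm g)\<^sup>2" by (intro power_mono) auto
    then show ?thesis by (simp add: na s_def c_def power_mult_distrib)
  qed
  show ?thesis
    unfolding bessel_family_def
  proof (intro exI[of _ "B\<^sup>2"] allI conjI)
    fix g
    show sm: "(\<lambda>i. (cmod (cinner g (T (ell2_basis i))))\<^sup>2) summable_on UNIV"
      by (rule nonneg_bounded_partial_sums_imp_summable_on[where C = "B\<^sup>2 * (norm g)\<^sup>2"])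
        (auto intro!: eventually_finite_subsets_at_top_weakI fin)
    show "(\<Sum>\<^sub>\<infinity>i. (cmod (cinner g (T (ell2_basis i))))\<^sup>2) \<le> B\<^sup>2 * (norm g)\<^sup>2"
      by (rule infsum_le_finite_sums[OF sm]) (rule fin)
  qed
qed

section \<open>\<open>J\<close>-frames\<close>

lemma unif_J_inter:
  assumes "unif_J_positive form S" "unif_J_negative form S'" "x \<in> S" "x \<in> S'"
  shows "x = 0"
proof -
  obtain a b where "a > 0" "b > 0" and "Re (form x x) \<ge> a * (norm x)\<^sup>2" "Re (form x x) \<le> - b * (norm x)\<^sup>2"
    using assms unfolding unif_J_positive_def unif_J_negative_def by blast
  then have "(a + b) * (norm x)\<^sup>2 \<le> 0" "a + b > 0" by (auto simp: algebra_simps)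
  then show ?thesis by (simp add: mult_le_0_iff)
qed

text \<open>Since the two subspaces span everything, an extension of one by
  \<open>u = s + s'\<close> would contain the component of \<open>u\<close> in the other. By
  definiteness that component is 0.\<close>

lemma max_unif_J_of_sum:
  fixes S S' :: "'h::complex_inner set"
  assumes S: "unif_J_positive form S" "unif_J_negative form S'"
    and sum: "\<And>z. \<exists>s\<in>S. \<exists>s'\<in>S'. z = s + s'"
  shows "max_unif_J_positive form S" "max_unif_J_negative form S'"
proof -
  have "U = S" if "unif_J_positive form U" "S \<subseteq> U" for U
  proof (intro equalityI that(2) subsetI)
    fix u assume u: "u \<in> U"
    obtain s s' where s: "s \<in> S" "s' \<in> S'" "u = s + s'" using sum by blast
    have "u - s \<in> U" using that s(1) u by (auto simp: unif_J_positive_def intro!: csubspaceD(3))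
    then have "s' = 0" using unif_J_inter[OF that(1) S(2), of s'] s by simp
    then show "u \<in> S" using s by simp
  qed
  then show "max_unif_J_positive form S" using S by (auto simp: max_unif_J_positive_def)
  have "U = S'" if "unif_J_negative form U" "S' \<subseteq> U" for U
  proof (intro equalityI that(2) subsetI)
    fix u assume u: "u \<in> U"
    obtain s s' where s: "s \<in> S" "s' \<in> S'" "u = s + s'" using sum by blast
    have "u - s' \<in> U" using that s(2) u by (auto simp: unif_J_negative_def intro!: csubspaceD(3))
    then have "s = 0" using unif_J_inter[OF S(1) that(1), of s] s by simp
    then show "u \<in> S'" using s by simp
  qed
  then show "max_unif_J_negative form S'" using S by (auto simp: max_unif_J_negative_def)
qed

lemma image_ell2_on_sum:
  assumes "bounded_clinear T" "surj T"
  shows "\<exists>s\<in>T ` ell2_on K. \<exists>s'\<in>T ` ell2_on (- K). z = s + s'"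
proof -
  obtain x where "z = T x" using assms(2) by blast
  then have "z = T (ell2_restrict K x) + T (ell2_restrict (- K) x)"
    by (simp add: bounded_clinearD(2)[OF assms(1), symmetric] flip: ell2_restrict_split)
  then show ?thesis using ell2_restrict_in by blast
qed

text \<open>Surjectivity of \<open>T\<close> carries the range and null space of the coordinate
  projection over to \<open>Q\<close>. If \<open>T\<close> annihilates the part of \<open>x\<close>
  on \<open>K\<close>, then \<open>T x\<close> is the image of the part off
  \<open>K\<close>.\<close>

lemma range_null_space_intertwined:
  assumes T: "bounded_clinear T" "surj T" and Q: "\<And>x. Q (T x) = T (ell2_restrict K x)"
  shows "range Q = T ` ell2_on K" "null_space Q = T ` ell2_on (- K)"
proof -
  note lin = bounded_clinearD[OF T(1)]
  have "range Q = range (\<lambda>x. Q (T x))" unfolding image_image[of Q T UNIV, symmetric] T(2) ..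
  also have "\<dots> = T ` ell2_on K"
  proof -
    have "range (ell2_restrict K) = ell2_on K"
    proof (intro equalityI subsetI)
      fix x assume "x \<in> ell2_on K"
      then show "x \<in> range (ell2_restrict K)" by (metis ell2_restrict_id rangeI)
    qed (use ell2_restrict_in in blast)
    then show ?thesis unfolding Q image_image[of T "ell2_restrict K" UNIV, symmetric] by simp
  qed
  finally show "range Q = T ` ell2_on K" .
  show "null_space Q = T ` ell2_on (- K)"
  proof (intro equalityI subsetI)
    fix y assume y: "y \<in> null_space Q"
    obtain x where x: "y = T x" using T(2) by blast
    have "T (ell2_restrict K x) = 0" using y Q x by (simp add: null_space_def)
    then have "y = T (ell2_restrict (- K) x)"
      using lin(2)[of "ell2_restrict K x" "ell2_restrict (- K) x"]
      by (simp add: x flip: ell2_restrict_split)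
    then show "y \<in> T ` ell2_on (- K)" using ell2_restrict_in by blast
  next
    fix y assume "y \<in> T ` ell2_on (- K)"
    then show "y \<in> null_space Q"
      by (auto simp: null_space_def Q ell2_restrict_compl_on lin(4))
  qed
qed

lemma Q_set_and_angle_of_splitting:
  fixes T :: "'i ell2 \<Rightarrow> 'h::chilbert_space"
  assumes T: "bounded_clinear T" "surj T"
    and pos: "unif_J_positive form (T ` ell2_on K)"
    and neg: "unif_J_negative form (T ` ell2_on (- K))"
  shows "friedrichs_cos (orth_compl (null_space T)) (ell2_on K) = 0"
    "T \<circ> ell2_restrict K \<circ> moore_penrose T \<in> Q_set form"
proof -
  note lin = bounded_clinearD[OF T(1)]
  note X = moore_penrose_of_surj[OF T]
  let ?R = "ell2_restrict K" and ?Q = "T \<circ> ell2_restrict K \<circ> moore_penrose T"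
  \<comment> \<open>For \<open>n\<close> in the null space, the images of its parts on and off
    \<open>K\<close> are opposite, so \<open>T (?R n)\<close> lies in both a positive and a negative
    subspace.\<close>
  have null: "T (?R n) = 0" if "T n = 0" for n
  proof (rule unif_J_inter[OF pos neg])
    show "T (?R n) \<in> T ` ell2_on K" by (intro imageI ell2_restrict_in)
    have "T n = T (?R n) + T (ell2_restrict (- K) n)"
      by (metis ell2_restrict_split lin(2))
    then have "T (?R n) = T (- 1 *\<^sub>C ell2_restrict (- K) n)"
      using that by (simp only: lin(5)) (simp add: scaleC_minus_one eq_neg_iff_add_eq_0)
    then show "T (?R n) \<in> T ` ell2_on (- K)"
      by (metis csubspaceD(5) csubspace_ell2_on ell2_restrict_in imageI)
  qed
  show "friedrichs_cos (orth_compl (null_space T)) (ell2_on K) = 0"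
  proof (rule friedrichs_cos_eq_0_of_invariant[of ?R])
    \<comment> \<open>A selfadjoint operator leaving the null space invariant also leaves its
      orthogonal complement invariant.\<close>
    fix x assume "x \<in> orth_compl (null_space T)"
    then show "?R x \<in> orth_compl (null_space T)"
      using null selfadjoint_ell2_restrict[of K]
      by (simp add: orth_compl_def null_space_def selfadjoint_op_def)
  qed (simp_all add: selfadjoint_ell2_restrict ell2_restrict_in ell2_restrict_id)
  have QT: "?Q (T x) = T (?R x)" for x
  proof -
    \<comment> \<open>\<open>x\<close> and \<open>moore_penrose T (T x)\<close> differ by a null
      vector of \<open>T\<close>, which \<open>null\<close> keeps null after restriction.\<close>
    have "T (?R (x - moore_penrose T (T x))) = 0" by (rule null) (simp add: lin X)
    then show ?thesis by (simp add: ell2_restrict_diff lin)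
  qed
  have "?Q \<circ> ?Q = ?Q"
  proof
    fix y
    obtain x where x: "y = T x" using T(2) by blast
    show "(?Q \<circ> ?Q) y = ?Q y"
      unfolding x comp_apply[of ?Q ?Q] QT by (simp add: ell2_restrict_id ell2_restrict_in)
  qed
  moreover have "bounded_clinear ?Q"
    by (intro bounded_clinear_compose T X bounded_clinear_ell2_restrict)
  ultimately show "?Q \<in> Q_set form"
    using pos neg range_null_space_intertwined[OF T, of ?Q K, OF QT] by (simp add: Q_set_def)
qed

text \<open>Idempotence of \<open>Q\<close> makes \<open>P = X T\<close> commute with the coordinate
  projection, where \<open>X\<close> is the Moore-Penrose inverse. This yields the intertwining that
  computes the range and null space of \<open>Q\<close>.\<close>

lemma splitting_of_Q_set:
  fixes T :: "'i ell2 \<Rightarrow> 'h::chilbert_space"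
  assumes T: "bounded_clinear T" "surj T"
    and Q: "T \<circ> ell2_restrict K \<circ> moore_penrose T \<in> Q_set form"
  shows "unif_J_positive form (T ` ell2_on K)" "unif_J_negative form (T ` ell2_on (- K))"
proof -
  note lin = bounded_clinearD[OF T(1)]
  note X = moore_penrose_of_surj[OF T]
  let ?R = "ell2_restrict K" and ?X = "moore_penrose T"
  let ?Q = "T \<circ> ?R \<circ> ?X"
  define P where "P = ?X \<circ> T"
  have "?Q \<circ> ?Q = ?Q" using Q by (simp add: Q_set_def)
  note QQ = this[THEN fun_cong]
  have idem: "P (?R (P (?R (P x)))) = P (?R (P x))" for x
    using arg_cong[OF QQ[of "T x"], of ?X] by (simp add: P_def)
  have comm: "P (?R x) = ?R (P x)" for x
  proof (rule projections_commute_of_idem_compression[of P ?R])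
    show "selfadjoint_op P" using X(3) by (simp add: P_def)
    show "P (x - y) = P x - P y" for x y
      by (simp add: P_def lin(3) bounded_clinearD(3)[OF X(1)])
  qed (simp_all add: idem selfadjoint_ell2_restrict ell2_restrict_id ell2_restrict_in
      ell2_restrict_diff, simp add: P_def X(2))
  \<comment> \<open>Apply \<open>T\<close> to the commutation relation and use
    \<open>T P = T\<close>.\<close>
  have "?Q (T x) = T (?R x)" for x
    using arg_cong[OF comm[of x], of T] X by (simp add: P_def)
  then show "unif_J_positive form (T ` ell2_on K)" "unif_J_negative form (T ` ell2_on (- K))"
    using Q range_null_space_intertwined[OF T, of ?Q K] by (simp_all add: Q_set_def)
qed

text \<open>\<open>K_plus\<close> may exceed \<open>K\<close>, but only by indices of vanishing frame vectors.\<close>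

lemma J_frame_of_splitting:
  fixes T :: "'i ell2 \<Rightarrow> 'h::chilbert_space"
  assumes T: "bounded_clinear T" "surj T"
    and pos: "unif_J_positive form (T ` ell2_on K)"
    and neg: "unif_J_negative form (T ` ell2_on (- K))"
  shows "J_frame form (\<lambda>i. T (ell2_basis i))"
proof -
  define f where "f i = T (ell2_basis i)" for i
  note lin = bounded_clinearD[OF T(1)]
  have basis_in: "ell2_basis i \<in> ell2_on L" if "i \<in> L" for i :: 'i and L
    using that by (auto simp: ell2_on_def ell2_basis.rep_eq)
  have sub: "K \<subseteq> K_plus form f"
  proof
    fix i assume "i \<in> K"
    then have "f i \<in> T ` ell2_on K" using basis_in by (auto simp: f_def)
    then obtain a where "a > 0" "Re (form (f i) (f i)) \<ge> a * (norm (f i))\<^sup>2"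
      using pos by (auto simp: unif_J_positive_def)
    then show "i \<in> K_plus form f"
      by (simp add: K_plus_def) (meson less_imp_le mult_nonneg_nonneg order_trans zero_le_power2)
  qed
  have f0: "f i = 0" if "i \<in> K_plus form f - K" for i
  proof -
    \<comment> \<open>Off \<open>K\<close> the vector \<open>f i\<close> is uniformly negative,
      while membership in \<open>K_plus\<close> makes its form value nonnegative; only 0 satisfies
      both.\<close>
    have "f i \<in> T ` ell2_on (- K)" using basis_in that by (auto simp: f_def)
    then obtain b where b: "b > 0" "Re (form (f i) (f i)) \<le> - b * (norm (f i))\<^sup>2"
      using neg unfolding unif_J_negative_def by blast
    then have "b * (norm (f i))\<^sup>2 \<le> 0" using that by (simp add: K_plus_def)
    then show ?thesis using b(1) by (simp add: mult_le_0_iff)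
  qed
  define Z where "Z = K_plus form f - K"
  have TZ: "T (ell2_restrict Z x) = 0" for x
    by (rule vanishes_on_ell2_on[OF T(1) _ ell2_restrict_in]) (use f0 in \<open>simp add: Z_def f_def\<close>)
  have TR: "T x = T (ell2_restrict (- Z) x)" for x
    using lin(2)[of "ell2_restrict Z x" "ell2_restrict (- Z) x"] TZ
    by (simp flip: ell2_restrict_split)
  \<comment> \<open>Indices in \<open>Z\<close> carry zero frame vectors, so adding or removing them
    leaves the image unchanged.\<close>
  have eq: "T ` ell2_on L = T ` ell2_on L'" if "L - Z \<subseteq> L'" "L' \<subseteq> L" for L L'
  proof
    show "T ` ell2_on L \<subseteq> T ` ell2_on L'"
    proof
      fix y assume "y \<in> T ` ell2_on L"
      then obtain x where x: "x \<in> ell2_on L" "y = T x" by blast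
      have "ell2_restrict (- Z) x \<in> ell2_on L'"
        using x that by (auto simp: ell2_on_def ell2_restrict.rep_eq)
      then show "y \<in> T ` ell2_on L'" using x TR by blast
    qed
  qed (use ell2_on_mono[OF that(2)] in blast)
  have "T ` ell2_on (K_plus form f) = T ` ell2_on K"
    using sub by (intro eq) (auto simp: Z_def)
  moreover have "K_minus form f = - K_plus form f" by (auto simp: K_plus_def K_minus_def)
  then have "T ` ell2_on (K_minus form f) = T ` ell2_on (- K)"
    using sub by (intro eq[symmetric]) (auto simp: Z_def)
  moreover note max_unif_J_of_sum[OF pos neg image_ell2_on_sum[OF T]]
  moreover have "is_synthesis_op f T" using T by (simp add: is_synthesis_op_def f_def)
  ultimately show ?thesis
    unfolding J_frame_def f_def[abs_def, symmetric]
    using bessel_family_of_bounded[OF T(1)] by (auto simp: f_def[abs_def])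
qed

theorem proposition4p2:
  fixes form :: "'h::chilbert_space \<Rightarrow> 'h \<Rightarrow> complex"
    and Hp Hm :: "'h set" and J :: "'h \<Rightarrow> 'h"
    and T :: "'i ell2 \<Rightarrow> 'h"
  assumes "krein_space form Hp Hm J"
    and "bounded_clinear T"
    and "surj T"
  shows "(\<exists>f. J_frame form f \<and> is_synthesis_op f T) \<longleftrightarrow>
    (\<exists>Ip :: 'i set.
        friedrichs_cos (orth_compl (null_space T)) (ell2_on Ip) < 1
      \<and> T \<circ> orth_proj (ell2_on Ip) \<circ> moore_penrose T \<in> Q_set form)"
proof
  assume "\<exists>f. J_frame form f \<and> is_synthesis_op f T"
  then obtain f T' where f: "is_synthesis_op f T" "is_synthesis_op f T'"
    "unif_J_positive form (T' ` ell2_on (K_plus form f))"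
    "unif_J_negative form (T' ` ell2_on (K_minus form f))"
    by (auto simp: J_frame_def max_unif_J_positive_def max_unif_J_negative_def)
  have "K_minus form f = - K_plus form f" by (auto simp: K_plus_def K_minus_def)
  \<comment> \<open>The sign sets of a family are complementary, so \<open>K_plus form f\<close>
    serves as the required index set.\<close>
  with f synthesis_op_unique[OF f(1,2)]
  have "unif_J_positive form (T ` ell2_on (K_plus form f))"
    "unif_J_negative form (T ` ell2_on (- K_plus form f))" by simp_all
  from Q_set_and_angle_of_splitting[OF assms(2,3) this]
  show "\<exists>Ip. friedrichs_cos (orth_compl (null_space T)) (ell2_on Ip) < 1
      \<and> T \<circ> orth_proj (ell2_on Ip) \<circ> moore_penrose T \<in> Q_set form"
    by (intro exI[of _ "K_plus form f"]) (simp add: orth_proj_ell2_on)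
next
  assume "\<exists>Ip. friedrichs_cos (orth_compl (null_space T)) (ell2_on Ip) < 1
      \<and> T \<circ> orth_proj (ell2_on Ip) \<circ> moore_penrose T \<in> Q_set form"
  then obtain Ip where "T \<circ> ell2_restrict Ip \<circ> moore_penrose T \<in> Q_set form"
    by (auto simp: orth_proj_ell2_on)
  note split = splitting_of_Q_set[OF assms(2,3) this]
  from J_frame_of_splitting[OF assms(2,3) split]
  show "\<exists>f. J_frame form f \<and> is_synthesis_op f T"
    using assms(2) by (auto simp: is_synthesis_op_def)
qed

end
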